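(* Let $\alpha\in\mathbb R\setminus\mathbb N$. Under the identification of $\mathcal F$ with $\phi(\mathcal F)$, where $\phi$ is determined by $(z_1,z_2,z_3,z_4)\mapsto(2^{-1}\ell_1^2,\ell_2\ell_3,\ell_1\ell_3,\ell_1\ell_2)$, the representation $\rho_0$ acting on $f=f(\ell_1,\ell_2,\ell_3)\in\phi(\mathcal F)$ is given, for all $k_1,k_2,k_3,a_1,a_3\in\mathbb R$, by \begin{align*} \rho_0(K_1(k_1))f&=f(\ell_1,\cos(k_1)\ell_2+2\sin(k_1)\ell_3,-2^{-1}\sin(k_1)\ell_2+\cos(k_1)\ell_3),\\ \rho_0(K_2(k_2))f&=\exp(\imath\alpha k_2)f(\exp(-\imath k_2)\ell_1,\ell_2,\ell_3),\\ \rho_0(K_3(k_3))f&=\exp(\imath k_3)f(\ell_1,\exp(-\imath k_3)\ell_2,\exp(-\imath k_3)\ell_3),\\ \rho_0(A_1(a_1))f&=f(\ell_1,\exp(a_1)\ell_2,\exp(-a_1)\ell_3),\\ \rho_0(A_3(a_3))f&=(\cosh(a_3)+\sinh(a_3)\ell_2\ell_3)f(\ell_1,\cosh(a_3)^{-1}\ell_2,\cosh(a_3)^{-1}\ell_3)\\ &\quad+\sinh(a_3)\Big(f(\ell_1,1,1)-f(\ell_1,1,0)-f(\ell_1,0,1)+f(\ell_1,0,0)\\ &\quad+\tanh(a_3)\big(f(\ell_1,\ell_2,\ell_3)-f(\ell_1,\ell_2,0)-f(\ell_1,0,\ell_3)+f(\ell_1,0,0)\big)\Big). \end{align*} Here the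 symbolic replacement of the odd variables $\ell_2,\ell_3$ by the constant $1$ uses the convention that every instance of $\ell_3\ell_2$ in $f$ is first rewritten as $-\ell_2\ell_3$.
   Context: Conventions: $\mathbb N=\{0,1,2,\dots\}$, $\imath$ is the imaginary unit, $(a)_k=a(a+1)\cdots(a+k-1)$. Polynomial Fock space: $F:=\mathcal P(\mathbb C^{2|2})/\mathcal I$, where $\mathcal P(\mathbb C^{2|2})$ denotes complex superpolynomials in even $z_1,z_2$ and odd $z_3,z_4$, and $\mathcal I$ is the ideal generated by $2z_1z_2+z_3z_4,\ z_2^2,\ z_2z_3,\ z_2z_4$. The classes of $z_1^k,z_1^kz_2,z_1^kz_3,z_1^kz_4$ ($k\in\mathbb N$) form a basis of $F$. Fock space: $\mathcal F$ is the completion of $F$ for the inner product $(\cdot,\cdot)_S$ for which this basis is orthogonal with $(z_1^k,z_1^k)_S=(z_1^kz_2,z_1^kz_2)_S=k!|(-\alpha)_k|$ and $(z_1^kz_3,z_1^kz_3)_S=(z_1^kz_4,z_1^kz_4)_S=2k!|(-\alpha)_{k+1}|$; its elements are series in this basis of finite norm. The map $\phi$: let $\ell_1$ be an even variable and $\ell_2,\ell_3$ odd variables, $\mathcal P_k(\mathbb C^{1|2})$ the homogeneous superpolynomials of degree $k$ in them, and $\mathcal P_{\mathrm{even}}(\mathbb C^{1|2})=\bigoplus_{k\ge0}\mathcal P_{2k}(\mathbb C^{1|2})$ ("even" refers to degree). The substitution $(z_1,z_2,z_3,z_4)\mapsto(2^{-1}\ell_1^2,\ell_2\ell_3,\ell_1\ell_3,\ell_1\ell_2)$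 defines an isomorphism $\phi:F\to\mathcal P_{\mathrm{even}}(\mathbb C^{1|2})$, extended to series in $\mathcal F$. Groups: $V_1,V_2,V_3$ are copies of $\mathbb R^2$; $G_0=SL(V_1)\times SL(V_2)\times SL(V_3)$; $\mathfrak{sl}(V_i)$ has basis $E_i=\begin{pmatrix}0&1\\0&0\end{pmatrix}$, $F_i=\begin{pmatrix}0&0\\1&0\end{pmatrix}$, $H_i=\begin{pmatrix}1&0\\0&-1\end{pmatrix}$; $K_i(k)=\begin{pmatrix}\cos k&-\sin k\\ \sin k&\cos k\end{pmatrix}=\exp(k(F_i-E_i))$, $A_i(a)=\begin{pmatrix}e^a&0\\0&e^{-a}\end{pmatrix}=\exp(aH_i)$. Action: with $\partial_i=\partial_{z_i}$, let $\mathcal B(z_1)=(-\alpha+z_1\partial_1+z_3\partial_3+z_4\partial_4)\partial_1-2\alpha z_2\partial_3\partial_4$ and $\mathcal B(z_2)=(-1+z_2\partial_2+z_3\partial_3+z_4\partial_4)\partial_2-2z_1\partial_3\partial_4$. The even part $\mathfrak g_{\bar0}=\mathfrak{sl}(V_1)\oplus\mathfrak{sl}(V_2)\oplus\mathfrak{sl}(V_3)$ acts on $F$ by $d\rho(F_1)=2z_3\partial_4$, $d\rho(E_1)=\tfrac12z_4\partial_3$, $d\rho(H_1)=z_4\partial_4-z_3\partial_3$, $d\rho(H_2)=z_1-\mathcal B(z_1)$, $d\rho(H_3)=z_2-\mathcal B(z_2)$, $d\rho(F_2)=-\tfrac{\imath}{2}(z_1+\mathcal B(z_1))-\tfrac{\imath}{2}(-\alpha+2z_1\partial_1+z_3\partial_3+z_4\partial_4)$,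 $d\rho(E_2)=-\tfrac{\imath}{2}(z_1+\mathcal B(z_1))+\tfrac{\imath}{2}(-\alpha+2z_1\partial_1+z_3\partial_3+z_4\partial_4)$, $d\rho(F_3)=-\tfrac{\imath}{2}(z_2+\mathcal B(z_2))-\tfrac{\imath}{2}(-1+2z_2\partial_2+z_3\partial_3+z_4\partial_4)$, $d\rho(E_3)=-\tfrac{\imath}{2}(z_2+\mathcal B(z_2))+\tfrac{\imath}{2}(-1+2z_2\partial_2+z_3\partial_3+z_4\partial_4)$. The action $\rho_0$ on $\mathcal F$ is defined by $\rho_0(\exp(X)):=\exp(d\rho(X))$ for $X\in\mathfrak g_{\bar0}$ and is transported to $\phi(\mathcal F)$ by $\phi$. *)

theory Defs
  imports "HOL-Analysis.Analysis"
begin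

unbundle no fps_syntax

section \<open>Superpolynomials in two odd variables\<close>

text \<open>
  \<^term>\<open>Gr a0 a1 a2 a12\<close> stands for \<open>a0 + a1 \<theta>\<^sub>1 + a2 \<theta>\<^sub>2 + a12 \<theta>\<^sub>1 \<theta>\<^sub>2\<close> in the exterior algebra on two
  odd generators over a commutative ring.  The superpolynomials on \<open>\<complex>\<^bsup>2|2\<^esup>\<close> are obtained over the
  ring \<open>\<complex>[z\<^sub>1][z\<^sub>2]\<close>, the series in \<open>\<ell>\<^sub>1, \<ell>\<^sub>2, \<ell>\<^sub>3\<close> over the ring \<open>\<complex>[[\<ell>\<^sub>1]]\<close>.
\<close>

datatype 'a grassmann = Gr (gr0: 'a) (gr1: 'a) (gr2: 'a) (gr12: 'a)

instantiation grassmann :: (comm_ring_1) ring_1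
begin

definition zero_grassmann :: "'a grassmann" where "0 = Gr 0 0 0 0"

definition one_grassmann :: "'a grassmann" where "1 = Gr 1 0 0 0"

definition plus_grassmann :: "'a grassmann \<Rightarrow> 'a grassmann \<Rightarrow> 'a grassmann" where
  "x + y = Gr (gr0 x + gr0 y) (gr1 x + gr1 y) (gr2 x + gr2 y) (gr12 x + gr12 y)"

definition minus_grassmann :: "'a grassmann \<Rightarrow> 'a grassmann \<Rightarrow> 'a grassmann" where
  "x - y = Gr (gr0 x - gr0 y) (gr1 x - gr1 y) (gr2 x - gr2 y) (gr12 x - gr12 y)"

definition uminus_grassmann :: "'a grassmann \<Rightarrow> 'a grassmann" where
  "- x = Gr (- gr0 x) (- gr1 x) (- gr2 x) (- gr12 x)"

definition times_grassmann :: "'a grassmann \<Rightarrow> 'a grassmann \<Rightarrow> 'a grassmann" where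
  "x * y = Gr (gr0 x * gr0 y)
              (gr0 x * gr1 y + gr1 x * gr0 y)
              (gr0 x * gr2 y + gr2 x * gr0 y)
              (gr0 x * gr12 y + gr12 x * gr0 y + gr1 x * gr2 y - gr2 x * gr1 y)"

instance
  by standard
    (auto simp: zero_grassmann_def one_grassmann_def plus_grassmann_def minus_grassmann_def uminus_grassmann_def times_grassmann_def
        algebra_simps intro: grassmann.expand)

end

lemma gr2_sel [simp]:
  "gr0 0 = 0" "gr1 0 = 0" "gr2 0 = 0" "gr12 0 = 0"
  "gr0 1 = 1" "gr1 1 = 0" "gr2 1 = 0" "gr12 1 = 0"
  "gr0 (x + y) = gr0 x + gr0 y" "gr1 (x + y) = gr1 x + gr1 y"
  "gr2 (x + y) = gr2 x + gr2 y" "gr12 (x + y) = gr12 x + gr12 y"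
  "gr0 (x - y) = gr0 x - gr0 y" "gr1 (x - y) = gr1 x - gr1 y"
  "gr2 (x - y) = gr2 x - gr2 y" "gr12 (x - y) = gr12 x - gr12 y"
  "gr0 (- x) = - gr0 x" "gr1 (- x) = - gr1 x" "gr2 (- x) = - gr2 x" "gr12 (- x) = - gr12 x"
  "gr0 (x * y) = gr0 x * gr0 y"
  "gr1 (x * y) = gr0 x * gr1 y + gr1 x * gr0 y"
  "gr2 (x * y) = gr0 x * gr2 y + gr2 x * gr0 y"
  "gr12 (x * y) = gr0 x * gr12 y + gr12 x * gr0 y + gr1 x * gr2 y - gr2 x * gr1 y"
  by (simp_all add: zero_grassmann_def one_grassmann_def plus_grassmann_def minus_grassmann_def uminus_grassmann_def times_grassmann_def)

lemma grassmann_numeral [simp]: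
  "gr0 (numeral n) = numeral n" "gr1 (numeral n) = 0" "gr2 (numeral n) = 0" "gr12 (numeral n) = 0"
  by (induction n) (simp_all only: numeral.simps gr2_sel, simp_all)

definition gr_const :: "'a::comm_ring_1 \<Rightarrow> 'a grassmann" where "gr_const a = Gr a 0 0 0"

definition \<theta>1 :: "'a::comm_ring_1 grassmann" where "\<theta>1 = Gr 0 1 0 0"

definition \<theta>2 :: "'a::comm_ring_1 grassmann" where "\<theta>2 = Gr 0 0 1 0"

lemma gr2_const_sel [simp]:
  "gr0 (gr_const a) = a" "gr1 (gr_const a) = 0" "gr2 (gr_const a) = 0" "gr12 (gr_const a) = 0"
  "gr0 \<theta>1 = 0" "gr1 \<theta>1 = 1" "gr2 \<theta>1 = 0" "gr12 \<theta>1 = 0"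
  "gr0 \<theta>2 = 0" "gr1 \<theta>2 = 0" "gr2 \<theta>2 = 1" "gr12 \<theta>2 = 0"
  by (simp_all add: gr_const_def \<theta>1_def \<theta>2_def)

type_synonym superpoly = "complex poly poly grassmann"

text \<open>The inner polynomial variable is \<open>z\<^sub>1\<close>, the outer one is \<open>z\<^sub>2\<close>.\<close>

definition cst :: "complex \<Rightarrow> superpoly" where "cst c = gr_const [:[:c:]:]"
definition Z1 :: superpoly where "Z1 = gr_const [:[:0, 1:]:]"
definition Z2 :: superpoly where "Z2 = gr_const [:0, 1:]"
definition Z3 :: superpoly where "Z3 = \<theta>1"
definition Z4 :: superpoly where "Z4 = \<theta>2"

definition D1 :: "superpoly \<Rightarrow> superpoly" where "D1 = map_grassmann (map_poly pderiv)"
definition D2 :: "superpoly \<Rightarrow> superpoly" where "D2 = map_grassmann pderiv"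

text \<open>Odd derivatives act from the left, so that \<open>\<partial>\<^sub>4 (z\<^sub>3 z\<^sub>4) = - z\<^sub>3\<close>.\<close>

definition D3 :: "superpoly \<Rightarrow> superpoly" where "D3 p = Gr (gr1 p) 0 (gr12 p) 0"
definition D4 :: "superpoly \<Rightarrow> superpoly" where "D4 p = Gr (gr2 p) (- gr12 p) 0 0"

lemmas super_defs = cst_def Z1_def Z2_def Z3_def Z4_def D1_def D2_def D3_def D4_def


section \<open>Polynomial Fock space\<close>

definition is_ideal :: "'a::ring_1 set \<Rightarrow> bool" where
  "is_ideal J \<longleftrightarrow> 0 \<in> J \<and> (\<forall>x\<in>J. \<forall>y\<in>J. x + y \<in> J) \<and> (\<forall>x\<in>J. \<forall>p. p * x \<in> J \<and> x * p \<in> J)"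

definition fock_ideal :: "superpoly set" where
  "fock_ideal = is_ideal hull {2 * Z1 * Z2 + Z3 * Z4, Z2 * Z2, Z2 * Z3, Z2 * Z4}"

lemma is_ideal_fock_ideal: "is_ideal fock_ideal"
  unfolding fock_ideal_def by (rule hull_in) (auto simp: is_ideal_def)

lemma fock_ideal_gens:
  "2 * Z1 * Z2 + Z3 * Z4 \<in> fock_ideal" "Z2 * Z2 \<in> fock_ideal"
  "Z2 * Z3 \<in> fock_ideal" "Z2 * Z4 \<in> fock_ideal"
  unfolding fock_ideal_def by (rule hull_inc; simp)+

text \<open>Reduction modulo the ideal: the coefficients of \<open>1, z\<^sub>2, z\<^sub>3, z\<^sub>4\<close>, as polynomials in \<open>z\<^sub>1\<close>.\<close>

lemma mem_fock_ideal_iff: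
  "p \<in> fock_ideal \<longleftrightarrow>
     coeff (gr0 p) 0 = 0 \<and> coeff (gr0 p) 1 = [:0, 2:] * coeff (gr12 p) 0 \<and>
     coeff (gr1 p) 0 = 0 \<and> coeff (gr2 p) 0 = 0" (is "_ \<longleftrightarrow> ?N p")
proof
  have id: "is_ideal {p. ?N p}"
    by (auto simp: is_ideal_def coeff_mult_0 coeff_mult atMost_Suc smult_add_right)
  have "{2 * Z1 * Z2 + Z3 * Z4, Z2 * Z2, Z2 * Z3, Z2 * Z4} \<subseteq> {p. ?N p}"
    by (auto simp: super_defs numeral_poly)
  then have "fock_ideal \<subseteq> {p. ?N p}"
    unfolding fock_ideal_def using id by (intro hull_minimal) auto
  then show "p \<in> fock_ideal \<Longrightarrow> ?N p" by blast
next
  assume N: "?N p"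
  obtain a0 p0 where p0: "gr0 p = pCons a0 p0" by (cases "gr0 p") auto
  obtain b0 p00 where p00: "p0 = pCons b0 p00" by (cases p0) auto
  obtain a1 p1 where p1: "gr1 p = pCons a1 p1" by (cases "gr1 p") auto
  obtain a2 p2 where p2: "gr2 p = pCons a2 p2" by (cases "gr2 p") auto
  obtain q p12 where p12: "gr12 p = pCons q p12" by (cases "gr12 p") auto
  have eqs: "a0 = 0" "b0 = [:0, 2:] * q" "a1 = 0" "a2 = 0"
    using N by (simp_all add: p0 p00 p1 p2 p12)
  have "p = gr_const p00 * (Z2 * Z2) + gr_const p1 * (Z2 * Z3) + gr_const p2 * (Z2 * Z4)
          + gr_const p12 * ((Z2 * Z3) * Z4) + gr_const [:q:] * (2 * Z1 * Z2 + Z3 * Z4)"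
    by (rule grassmann.expand) (simp add: super_defs numeral_poly p0 p00 p1 p2 p12 eqs)
  also have "\<dots> \<in> fock_ideal"
    using is_ideal_fock_ideal fock_ideal_gens unfolding is_ideal_def by blast
  finally show "p \<in> fock_ideal" .
qed

definition fock_rel :: "superpoly \<Rightarrow> superpoly \<Rightarrow> bool" where
  "fock_rel p q \<longleftrightarrow> p - q \<in> fock_ideal"

quotient_type fock_poly = superpoly / fock_rel
proof (rule equivpI)
  show "reflp fock_rel" by (simp add: reflp_def fock_rel_def mem_fock_ideal_iff)
  show "symp fock_rel"
    unfolding symp_def fock_rel_def
  proof (intro allI impI)
    fix x y :: superpoly assume "x - y \<in> fock_ideal"
    then have "(- 1) * (x - y) \<in> fock_ideal"
      using is_ideal_fock_ideal unfolding is_ideal_def by blast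
    then show "y - x \<in> fock_ideal" by simp
  qed
  show "transp fock_rel"
    unfolding transp_def fock_rel_def
  proof (intro allI impI)
    fix x y z :: superpoly assume "x - y \<in> fock_ideal" "y - z \<in> fock_ideal"
    then have "(x - y) + (y - z) \<in> fock_ideal"
      using is_ideal_fock_ideal unfolding is_ideal_def by blast
    then show "x - z \<in> fock_ideal" by simp
  qed
qed

datatype gen = G1 | Gz2 | Gz3 | Gz4

text \<open>The index \<open>(k, g)\<close> stands for \<open>z\<^sub>1\<^sup>k\<close>, \<open>z\<^sub>1\<^sup>k z\<^sub>2\<close>, \<open>z\<^sub>1\<^sup>k z\<^sub>3\<close> or \<open>z\<^sub>1\<^sup>k z\<^sub>4\<close>.\<close>

type_synonym idx = "nat \<times> gen"

fun gen_var :: "gen \<Rightarrow> superpoly" where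
  "gen_var G1 = 1"
| "gen_var Gz2 = Z2"
| "gen_var Gz3 = Z3"
| "gen_var Gz4 = Z4"

definition monomial :: "idx \<Rightarrow> superpoly" where
  "monomial b = Z1 ^ fst b * gen_var (snd b)"

definition fin_coeffs :: "(idx \<Rightarrow> complex) set" where
  "fin_coeffs = {c. finite {b. c b \<noteq> 0}}"

definition of_coeffs :: "(idx \<Rightarrow> complex) \<Rightarrow> fock_poly" where
  "of_coeffs c = abs_fock_poly (\<Sum>b | c b \<noteq> 0. cst (c b) * monomial b)"

definition coords :: "fock_poly \<Rightarrow> idx \<Rightarrow> complex" where
  "coords = inv_into fin_coeffs of_coeffs"


text \<open>The coefficient of a generator in the normal form of a superpolynomial modulo the ideal.\<close>

fun normal_form :: "gen \<Rightarrow> superpoly \<Rightarrow> complex poly" where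
  "normal_form G1 p = coeff (gr0 p) 0"
| "normal_form Gz2 p = coeff (gr0 p) 1 - [:0, 2:] * coeff (gr12 p) 0"
| "normal_form Gz3 p = coeff (gr1 p) 0"
| "normal_form Gz4 p = coeff (gr2 p) 0"

lemma mem_fock_ideal_iff_normal_form: "p \<in> fock_ideal \<longleftrightarrow> (\<forall>g. normal_form g p = 0)"
proof
  show "p \<in> fock_ideal \<Longrightarrow> \<forall>g. normal_form g p = 0"
  proof
    fix g assume "p \<in> fock_ideal"
    then show "normal_form g p = 0" by (cases g) (auto simp: mem_fock_ideal_iff)
  qed
  assume *: "\<forall>g. normal_form g p = 0"
  show "p \<in> fock_ideal"
    using *[rule_format, of G1] *[rule_format, of Gz2] *[rule_format, of Gz3] *[rule_format, of Gz4]
    by (auto simp: mem_fock_ideal_iff)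
qed

lemma normal_form_add: "normal_form g (p + q) = normal_form g p + normal_form g q"
  by (cases g) (simp_all add: smult_add_right)

lemma normal_form_diff: "normal_form g (p - q) = normal_form g p - normal_form g q"
  by (cases g) (simp_all add: smult_diff_right)

lemma normal_form_sum: "normal_form g (sum f A) = (\<Sum>x\<in>A. normal_form g (f x))"
proof -
  have "normal_form g 0 = 0" by (cases g) auto
  then show ?thesis
    by (induction A rule: infinite_finite_induct) (simp_all add: normal_form_add)
qed

lemma Z1_power: "Z1 ^ k = gr_const [:monom 1 k:]"
  by (induction k) (auto intro!: grassmann.expand simp: Z1_def monom_Suc monom_0 one_pCons)

lemma normal_form_monomial:
  "normal_form g (cst a * monomial b) = (if g = snd b then monom a (fst b) else 0)"
  by (cases g; cases "snd b") (simp_all add: monomial_def Z1_power cst_def Z2_def Z3_def Z4_def smult_monom coeff_pCons)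

lemma coeff_normal_form_sum:
  assumes "c \<in> fin_coeffs"
  shows "coeff (normal_form g (\<Sum>b | c b \<noteq> 0. cst (c b) * monomial b)) k = c (k, g)"
proof -
  have fin: "finite {b. c b \<noteq> 0}" using assms by (simp add: fin_coeffs_def)
  have "coeff (normal_form g (\<Sum>b | c b \<noteq> 0. cst (c b) * monomial b)) k
      = (\<Sum>b | c b \<noteq> 0. if b = (k, g) then c b else 0)"
    by (auto simp: normal_form_sum normal_form_monomial coeff_sum prod_eq_iff intro!: sum.cong)
  also have "\<dots> = c (k, g)"
    using fin by (simp add: sum.delta)
  finally show ?thesis .
qed

text \<open>The classes of the monomials form a basis.\<close>

lemma bij_betw_of_coeffs: "bij_betw of_coeffs fin_coeffs UNIV"
  unfolding bij_betw_def
proof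
  show "inj_on of_coeffs fin_coeffs"
  proof (rule inj_onI)
    fix c d assume c: "c \<in> fin_coeffs" and d: "d \<in> fin_coeffs" and eq: "of_coeffs c = of_coeffs d"
    let ?S = "\<lambda>c. \<Sum>b | c b \<noteq> 0. cst (c b) * monomial b"
    have "?S c - ?S d \<in> fock_ideal"
      using eq by (simp add: of_coeffs_def fock_poly.abs_eq_iff fock_rel_def)
    then have "normal_form g (?S c) = normal_form g (?S d)" for g
      by (simp add: mem_fock_ideal_iff_normal_form normal_form_diff)
    then have "c (k, g) = d (k, g)" for k g
      using coeff_normal_form_sum[OF c, of g k] coeff_normal_form_sum[OF d, of g k] by simp
    then show "c = d" by auto
  qed
  have "\<exists>c\<in>fin_coeffs. of_coeffs c = v" for v
  proof -
    obtain p where v: "v = abs_fock_poly p"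
      using Quotient3_abs_rep[OF Quotient3_fock_poly] by metis
    define c where "c = (\<lambda>(k, g). coeff (normal_form g p) k)"
    have UN: "(UNIV :: gen set) = {G1, Gz2, Gz3, Gz4}"
      by (auto intro: gen.exhaust)
    have "{b. c b \<noteq> 0} \<subseteq> (\<Union>g. {..degree (normal_form g p)} \<times> {g})"
      by (auto simp: c_def intro: le_degree)
    moreover have "finite (\<Union>g. {..degree (normal_form g p)} \<times> {g :: gen})"
      unfolding UN by simp
    ultimately have c: "c \<in> fin_coeffs"
      unfolding fin_coeffs_def by (auto intro: finite_subset)
    have "normal_form g (\<Sum>b | c b \<noteq> 0. cst (c b) * monomial b) = normal_form g p" for g
      by (rule poly_eqI) (simp add: coeff_normal_form_sum[OF c], simp add: c_def)
    then have "of_coeffs c = v"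
      by (simp add: of_coeffs_def v fock_poly.abs_eq_iff fock_rel_def
          mem_fock_ideal_iff_normal_form normal_form_diff)
    with c show ?thesis by blast
  qed
  then show "of_coeffs ` fin_coeffs = UNIV" by (metis UNIV_eq_I imageI)
qed

section \<open>The action on the polynomial Fock space\<close>

definition Bz1 :: "real \<Rightarrow> superpoly \<Rightarrow> superpoly" where
  "Bz1 \<alpha> p = cst (- of_real \<alpha>) * D1 p + Z1 * D1 (D1 p) + Z3 * D3 (D1 p) + Z4 * D4 (D1 p)
     - cst (2 * of_real \<alpha>) * Z2 * D3 (D4 p)"

definition Bz2 :: "superpoly \<Rightarrow> superpoly" where
  "Bz2 p = cst (- 1) * D2 p + Z2 * D2 (D2 p) + Z3 * D3 (D2 p) + Z4 * D4 (D2 p)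
     - 2 * Z1 * D3 (D4 p)"

definition Eul1 :: "real \<Rightarrow> superpoly \<Rightarrow> superpoly" where
  "Eul1 \<alpha> p = cst (- of_real \<alpha>) * p + 2 * Z1 * D1 p + Z3 * D3 p + Z4 * D4 p"

definition Eul2 :: "superpoly \<Rightarrow> superpoly" where
  "Eul2 p = cst (- 1) * p + 2 * Z2 * D2 p + Z3 * D3 p + Z4 * D4 p"

definition dF1 :: "superpoly \<Rightarrow> superpoly" where "dF1 p = 2 * Z3 * D4 p"
definition dE1 :: "superpoly \<Rightarrow> superpoly" where "dE1 p = cst (1 / 2) * Z4 * D3 p"
definition dH1 :: "superpoly \<Rightarrow> superpoly" where "dH1 p = Z4 * D4 p - Z3 * D3 p"

definition dF2 :: "real \<Rightarrow> superpoly \<Rightarrow> superpoly" where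
  "dF2 \<alpha> p = cst (- \<i> / 2) * (Z1 * p + Bz1 \<alpha> p) - cst (\<i> / 2) * Eul1 \<alpha> p"
definition dE2 :: "real \<Rightarrow> superpoly \<Rightarrow> superpoly" where
  "dE2 \<alpha> p = cst (- \<i> / 2) * (Z1 * p + Bz1 \<alpha> p) + cst (\<i> / 2) * Eul1 \<alpha> p"
definition dH2 :: "real \<Rightarrow> superpoly \<Rightarrow> superpoly" where
  "dH2 \<alpha> p = Z1 * p - Bz1 \<alpha> p"

definition dF3 :: "superpoly \<Rightarrow> superpoly" where
  "dF3 p = cst (- \<i> / 2) * (Z2 * p + Bz2 p) - cst (\<i> / 2) * Eul2 p"
definition dE3 :: "superpoly \<Rightarrow> superpoly" where
  "dE3 p = cst (- \<i> / 2) * (Z2 * p + Bz2 p) + cst (\<i> / 2) * Eul2 p"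
definition dH3 :: "superpoly \<Rightarrow> superpoly" where
  "dH3 p = Z2 * p - Bz2 p"

text \<open>
  A triple \<open>(X\<^sub>1, X\<^sub>2, X\<^sub>3)\<close> of traceless matrices is the element \<open>X\<^sub>1 + X\<^sub>2 + X\<^sub>3\<close> of the even part of
  the Lie superalgebra (the type does not enforce zero trace).  For such matrices
  \<open>X\<^sub>i = X\<^sub>i $ 1 $ 2 E\<^sub>i + X\<^sub>i $ 2 $ 1 F\<^sub>i + X\<^sub>i $ 1 $ 1 H\<^sub>i\<close>.
\<close>

type_synonym sl2_triple = "(real^2^2) \<times> (real^2^2) \<times> (real^2^2)"

fun drho_op :: "real \<Rightarrow> sl2_triple \<Rightarrow> superpoly \<Rightarrow> superpoly" where
  "drho_op \<alpha> (X1, X2, X3) p =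
     cst (X1 $ 1 $ 2) * dE1 p + cst (X1 $ 2 $ 1) * dF1 p + cst (X1 $ 1 $ 1) * dH1 p
   + cst (X2 $ 1 $ 2) * dE2 \<alpha> p + cst (X2 $ 2 $ 1) * dF2 \<alpha> p + cst (X2 $ 1 $ 1) * dH2 \<alpha> p
   + cst (X3 $ 1 $ 2) * dE3 p + cst (X3 $ 2 $ 1) * dF3 p + cst (X3 $ 1 $ 1) * dH3 p"

lemma D_diff:
  "D1 (p - q) = D1 p - D1 q" "D2 (p - q) = D2 p - D2 q"
  "D3 (p - q) = D3 p - D3 q" "D4 (p - q) = D4 p - D4 q"
proof -
  have "map_poly pderiv (a - b) = map_poly pderiv a - map_poly pderiv b" for a b :: "complex poly poly"
    by (rule poly_eqI) (simp add: coeff_map_poly pderiv_diff)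
  then show "D1 (p - q) = D1 p - D1 q"
    by (intro grassmann.expand) (simp add: D1_def grassmann.map_sel)
qed (auto intro!: grassmann.expand simp: super_defs grassmann.map_sel pderiv_diff)

lemmas dops_def = Bz1_def Bz2_def Eul1_def Eul2_def dF1_def dE1_def dH1_def dF2_def dE2_def dH2_def
  dF3_def dE3_def dH3_def

lemma drho_op_diff: "drho_op \<alpha> X (p - q) = drho_op \<alpha> X p - drho_op \<alpha> X q"
  by (cases X) (simp add: dops_def D_diff algebra_simps)

lemma fock_ideal_closed:
  assumes "x \<in> fock_ideal" "y \<in> fock_ideal"
  shows "x + y \<in> fock_ideal" "x - y \<in> fock_ideal" "p * x \<in> fock_ideal"
proof -
  show *: "p * x \<in> fock_ideal" "x + y \<in> fock_ideal" for p
    using assms is_ideal_fock_ideal unfolding is_ideal_def by blast+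
  have "x + (- 1) * y \<in> fock_ideal"
    using assms is_ideal_fock_ideal unfolding is_ideal_def by blast
  then show "x - y \<in> fock_ideal" by simp
qed

lemma fock_ideal_ops:
  assumes "p \<in> fock_ideal"
  shows "Bz1 \<alpha> p \<in> fock_ideal" "Bz2 p \<in> fock_ideal" "Eul1 \<alpha> p \<in> fock_ideal" "Eul2 p \<in> fock_ideal"
    "dE1 p \<in> fock_ideal" "dF1 p \<in> fock_ideal" "dH1 p \<in> fock_ideal"
  using assms
  by (simp_all add: mem_fock_ideal_iff dops_def super_defs grassmann.map_sel coeff_map_poly
      coeff_pderiv numeral_poly pderiv_pCons pderiv_smult pderiv_add coeff_pCons
      algebra_simps smult_add_right smult_diff_right)

lemma fock_ideal_drho_op:
  assumes "p \<in> fock_ideal" shows "drho_op \<alpha> X p \<in> fock_ideal"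
  by (cases X) (auto simp: dF2_def dE2_def dH2_def dF3_def dE3_def dH3_def
      intro!: fock_ideal_closed fock_ideal_ops assms)

lift_definition drho :: "real \<Rightarrow> sl2_triple \<Rightarrow> fock_poly \<Rightarrow> fock_poly" is drho_op
  by (simp add: fock_rel_def fock_ideal_drho_op flip: drho_op_diff)


section \<open>The map to series in \<open>\<ell>\<^sub>1, \<ell>\<^sub>2, \<ell>\<^sub>3\<close>\<close>

type_synonym lseries = "complex fps grassmann"

definition lcst :: "complex \<Rightarrow> lseries" where "lcst c = gr_const (fps_const c)"
definition L1 :: lseries where "L1 = gr_const fps_X"
definition L2 :: lseries where "L2 = \<theta>1"
definition L3 :: lseries where "L3 = \<theta>2"

text \<open>
  Substitution in \<open>f = \<Sum>\<^sub>n \<ell>\<^sub>1\<^sup>n (a\<^sub>n + b\<^sub>n \<ell>\<^sub>2 + c\<^sub>n \<ell>\<^sub>3 + d\<^sub>n \<ell>\<^sub>2 \<ell>\<^sub>3)\<close>, for arbitrary \<open>y\<^sub>2, y\<^sub>3\<close>, not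
  necessarily odd.  Since \<open>\<ell>\<^sub>2\<close> precedes \<open>\<ell>\<^sub>3\<close> in this normal form, replacing \<open>\<ell>\<^sub>2, \<ell>\<^sub>3\<close> by constants
  follows the convention that \<open>\<ell>\<^sub>3 \<ell>\<^sub>2\<close> is first rewritten as \<open>- \<ell>\<^sub>2 \<ell>\<^sub>3\<close>.  The series \<open>x\<close> replacing
  \<open>\<ell>\<^sub>1\<close> has to have zero constant term.
\<close>

definition lsubst :: "lseries \<Rightarrow> complex fps \<Rightarrow> lseries \<Rightarrow> lseries \<Rightarrow> lseries" where
  "lsubst f x y2 y3 =
     gr_const (fps_compose (gr0 f) x) + gr_const (fps_compose (gr1 f) x) * y2
   + gr_const (fps_compose (gr2 f) x) * y3 + gr_const (fps_compose (gr12 f) x) * y2 * y3"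

definition zsubst_even :: "complex poly poly \<Rightarrow> lseries \<Rightarrow> lseries \<Rightarrow> lseries" where
  "zsubst_even q x1 x2 =
     (\<Sum>i\<le>degree q. \<Sum>j\<le>degree (coeff q i). lcst (coeff (coeff q i) j) * x1 ^ j * x2 ^ i)"

definition zsubst :: "superpoly \<Rightarrow> lseries \<Rightarrow> lseries \<Rightarrow> lseries \<Rightarrow> lseries \<Rightarrow> lseries" where
  "zsubst p x1 x2 x3 x4 =
     zsubst_even (gr0 p) x1 x2 + zsubst_even (gr1 p) x1 x2 * x3
   + zsubst_even (gr2 p) x1 x2 * x4 + zsubst_even (gr12 p) x1 x2 * x3 * x4"

definition phi_op :: "superpoly \<Rightarrow> lseries" where
  "phi_op p = zsubst p (lcst (1 / 2) * L1 ^ 2) (L2 * L3) (L1 * L3) (L1 * L2)"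

definition half_sq_subst :: "complex poly \<Rightarrow> complex fps" where
  "half_sq_subst r = poly (map_poly fps_const r) (fps_const (1 / 2) * fps_X ^ 2)"

lemma gr_const_hom:
  fixes a b :: "'a::comm_ring_1"
  shows "gr_const (0 :: 'a) = 0" "gr_const (a + b) = gr_const a + gr_const b"
    "gr_const (a - b) = gr_const a - gr_const b" "gr_const (a * b) = gr_const a * gr_const b"
  by (rule grassmann.expand; simp)+

lemma gr_const_power: "gr_const (a ^ n) = gr_const a ^ n"
proof -
  have "gr_const (1 :: 'a) = 1" by (rule grassmann.expand) simp
  then show ?thesis by (induction n) (simp_all add: gr_const_hom)
qed

lemma gr_const_sum: "gr_const (sum f A) = (\<Sum>x\<in>A. gr_const (f x))"
  by (induction A rule: infinite_finite_induct) (simp_all add: gr_const_hom)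

lemma zsubst_even_phi:
  "zsubst_even q (lcst (1 / 2) * L1 ^ 2) (L2 * L3) =
     gr_const (half_sq_subst (coeff q 0)) + gr_const (half_sq_subst (coeff q 1)) * (L2 * L3)"
proof -
  let ?x = "fps_const (1 / 2) * fps_X ^ 2 :: complex fps"
  have inner: "(\<Sum>j\<le>degree r. lcst (coeff r j) * (lcst (1 / 2) * L1 ^ 2) ^ j) = gr_const (half_sq_subst r)"
    for r
  proof -
    have "half_sq_subst r = (\<Sum>j\<le>degree r. fps_const (coeff r j) * ?x ^ j)"
      unfolding half_sq_subst_def poly_altdef
      by (simp add: coeff_map_poly degree_map_poly)
    then show ?thesis by (simp add: gr_const_hom gr_const_power gr_const_sum lcst_def L1_def)
  qed
  have nil: "(L2 * L3) * (L2 * L3) = 0"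
    by (rule grassmann.expand) (simp add: L2_def L3_def)
  have nil': "(L2 * L3) ^ i = 0" if "i \<ge> 2" for i
  proof -
    have "i = Suc (Suc (i - 2))" using that by simp
    then obtain m where "i = Suc (Suc m)" ..
    then have "(L2 * L3) ^ i = ((L2 * L3) * (L2 * L3)) * (L2 * L3) ^ m"
      by (simp only: power_Suc mult.assoc)
    then show ?thesis by (simp only: nil mult_zero_left)
  qed
  have h0: "half_sq_subst 0 = 0" by (simp add: half_sq_subst_def)
  let ?f = "\<lambda>i. gr_const (half_sq_subst (coeff q i)) * (L2 * L3) ^ i"
  have "zsubst_even q (lcst (1 / 2) * L1 ^ 2) (L2 * L3) = (\<Sum>i\<le>degree q. ?f i)"
    unfolding zsubst_even_def inner[symmetric] sum_distrib_right ..
  also have "\<dots> = (\<Sum>i\<le>max 1 (degree q). ?f i)"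
    by (rule sum.mono_neutral_left) (auto simp: coeff_eq_0 h0 gr_const_hom)
  also have "\<dots> = (\<Sum>i\<le>1. ?f i)"
    by (rule sum.mono_neutral_right) (auto simp: nil')
  finally show ?thesis by simp
qed

lemma half_sq_subst_add: "half_sq_subst (r + s) = half_sq_subst r + half_sq_subst s"
proof -
  have "map_poly fps_const (r + s) = map_poly fps_const r + map_poly fps_const s"
    by (rule poly_eqI) (simp add: coeff_map_poly)
  then show ?thesis by (simp add: half_sq_subst_def)
qed

lemma half_sq_subst_diff: "half_sq_subst (r - s) = half_sq_subst r - half_sq_subst s"
  using half_sq_subst_add[of "r - s" s] by simp

lemma half_sq_subst_z1: "half_sq_subst ([:0, 2:] * r) = fps_X ^ 2 * half_sq_subst r"
proof -
  have eq: "map_poly fps_const ([:0, 2:] * r) = pCons 0 (smult (fps_const 2) (map_poly fps_const r))"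
    by (rule poly_eqI) (simp add: coeff_map_poly coeff_pCons split: nat.splits)
  have "half_sq_subst ([:0, 2:] * r) = (fps_const (1 / 2) * fps_const 2) * (fps_X ^ 2 * half_sq_subst r)"
    unfolding half_sq_subst_def eq by (simp add: algebra_simps del: fps_const_mult)
  then show ?thesis by simp
qed

lemma phi_op_diff: "phi_op (p - q) = phi_op p - phi_op q"
  by (simp add: phi_op_def zsubst_def zsubst_even_phi half_sq_subst_diff gr_const_hom algebra_simps)

lemma phi_op_fock_ideal:
  assumes "p \<in> fock_ideal" shows "phi_op p = 0"
proof -
  have h0: "half_sq_subst 0 = 0" by (simp add: half_sq_subst_def)
  show ?thesis
    using assms
    by (intro grassmann.expand, simp only: phi_op_def zsubst_def zsubst_even_phi)
      (simp add: mem_fock_ideal_iff h0 half_sq_subst_z1[simplified] L1_def L2_def L3_def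
        power2_eq_square)
qed

lift_definition phi_poly :: "fock_poly \<Rightarrow> lseries" is phi_op
  using phi_op_fock_ideal phi_op_diff by (metis fock_rel_def right_minus_eq)


section \<open>The Fock space\<close>

fun fock_weight :: "real \<Rightarrow> idx \<Rightarrow> real" where
  "fock_weight \<alpha> (k, G1) = fact k * \<bar>pochhammer (- \<alpha>) k\<bar>"
| "fock_weight \<alpha> (k, Gz2) = fact k * \<bar>pochhammer (- \<alpha>) k\<bar>"
| "fock_weight \<alpha> (k, Gz3) = 2 * fact k * \<bar>pochhammer (- \<alpha>) (k + 1)\<bar>"
| "fock_weight \<alpha> (k, Gz4) = 2 * fact k * \<bar>pochhammer (- \<alpha>) (k + 1)\<bar>"

text \<open>Elements of the completion are represented by their coefficients in the monomial basis.\<close>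

definition fock :: "real \<Rightarrow> (idx \<Rightarrow> complex) set" where
  "fock \<alpha> = {c. (\<lambda>b. fock_weight \<alpha> b * (cmod (c b))\<^sup>2) summable_on UNIV}"

definition fock_inner :: "real \<Rightarrow> (idx \<Rightarrow> complex) \<Rightarrow> (idx \<Rightarrow> complex) \<Rightarrow> complex" where
  "fock_inner \<alpha> c d = (\<Sum>\<^sub>\<infinity>b. of_real (fock_weight \<alpha> b) * c b * cnj (d b))"

definition fock_norm :: "real \<Rightarrow> (idx \<Rightarrow> complex) \<Rightarrow> real" where
  "fock_norm \<alpha> c = sqrt (Re (fock_inner \<alpha> c c))"

text \<open>
  Termwise extension of the map to series; each coefficient of the result is a finite sum.
\<close>

definition phi :: "(idx \<Rightarrow> complex) \<Rightarrow> lseries" where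
  "phi c =
     (let img = (\<lambda>b. phi_poly (abs_fock_poly (monomial b)));
          comp = (\<lambda>\<pi>. Abs_fps (\<lambda>n. \<Sum>\<^sub>\<infinity>b. c b * fps_nth (\<pi> (img b)) n))
      in Gr (comp gr0) (comp gr1) (comp gr2) (comp gr12))"


section \<open>Exponentials of operators and the group action\<close>

text \<open>
  The exponential of an operator \<open>A\<close> defined on the dense subspace of polynomials: the value at
  time 1 of the strongly continuous one-parameter group of bounded operators on the Fock space
  whose generator extends \<open>A\<close>.
\<close>

definition fock_bounded :: "real \<Rightarrow> ((idx \<Rightarrow> complex) \<Rightarrow> idx \<Rightarrow> complex) \<Rightarrow> bool" where
  "fock_bounded \<alpha> T \<longleftrightarrow>
     (\<forall>c\<in>fock \<alpha>. T c \<in> fock \<alpha>) \<and>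
     (\<forall>c\<in>fock \<alpha>. \<forall>d\<in>fock \<alpha>. T (\<lambda>b. c b + d b) = (\<lambda>b. T c b + T d b)) \<and>
     (\<forall>c\<in>fock \<alpha>. \<forall>s. T (\<lambda>b. s * c b) = (\<lambda>b. s * T c b)) \<and>
     (\<exists>M. \<forall>c\<in>fock \<alpha>. fock_norm \<alpha> (T c) \<le> M * fock_norm \<alpha> c)"

definition fock_group :: "real \<Rightarrow> (real \<Rightarrow> (idx \<Rightarrow> complex) \<Rightarrow> idx \<Rightarrow> complex) \<Rightarrow> bool" where
  "fock_group \<alpha> U \<longleftrightarrow>
     (\<forall>t. fock_bounded \<alpha> (U t)) \<and>
     (\<forall>c\<in>fock \<alpha>. U 0 c = c) \<and>
     (\<forall>s t. \<forall>c\<in>fock \<alpha>. U (s + t) c = U s (U t c)) \<and>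
     (\<forall>c\<in>fock \<alpha>. ((\<lambda>t. fock_norm \<alpha> (\<lambda>b. U t c b - c b)) \<longlongrightarrow> 0) (at 0))"

definition generated_by ::
  "real \<Rightarrow> (real \<Rightarrow> (idx \<Rightarrow> complex) \<Rightarrow> idx \<Rightarrow> complex) \<Rightarrow> (fock_poly \<Rightarrow> fock_poly) \<Rightarrow> bool" where
  "generated_by \<alpha> U A \<longleftrightarrow>
     (\<forall>v. ((\<lambda>t. fock_norm \<alpha> (\<lambda>b. (U t (coords v) b - coords v b) / of_real t - coords (A v) b)) \<longlongrightarrow> 0)
            (at 0))"

definition op_exp :: "real \<Rightarrow> (fock_poly \<Rightarrow> fock_poly) \<Rightarrow> (idx \<Rightarrow> complex) \<Rightarrow> idx \<Rightarrow> complex" where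
  "op_exp \<alpha> A c = (THE d. \<exists>U. fock_group \<alpha> U \<and> generated_by \<alpha> U A \<and> d = U 1 c)"

text \<open>
  \<^term>\<open>rho0_exp \<alpha> X\<close> is \<open>\<rho>\<^sub>0(exp X)\<close>, transported to series in \<open>\<ell>\<^sub>1, \<ell>\<^sub>2, \<ell>\<^sub>3\<close>.  It is a function of \<open>X\<close>
  and not of the matrices \<open>exp X\<close>: for \<open>X = 2 \<pi> (F\<^sub>2 - E\<^sub>2)\<close> the latter are trivial, but
  \<open>\<rho>\<^sub>0(exp X)\<close> is multiplication by \<open>exp(2 \<pi> \<i> \<alpha>)\<close>.
\<close>

definition rho0_exp :: "real \<Rightarrow> sl2_triple \<Rightarrow> lseries \<Rightarrow> lseries" where
  "rho0_exp \<alpha> X f = phi (op_exp \<alpha> (drho \<alpha> X) (inv_into (fock \<alpha>) phi f))"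

definition matE :: "real^2^2" where "matE = vector [vector [0, 1], vector [0, 0]]"
definition matF :: "real^2^2" where "matF = vector [vector [0, 0], vector [1, 0]]"
definition matH :: "real^2^2" where "matH = vector [vector [1, 0], vector [0, - 1]]"

definition matK :: "real \<Rightarrow> real^2^2" where
  "matK k = vector [vector [cos k, - sin k], vector [sin k, cos k]]"
definition matA :: "real \<Rightarrow> real^2^2" where
  "matA a = vector [vector [exp a, 0], vector [0, exp (- a)]]"

lemma mat2_eqI:
  fixes M N :: "real^2^2"
  assumes "M $ 1 $ 1 = N $ 1 $ 1" "M $ 1 $ 2 = N $ 1 $ 2" "M $ 2 $ 1 = N $ 2 $ 1" "M $ 2 $ 2 = N $ 2 $ 2"
  shows "M = N"
  using assms by (simp add: vec_eq_iff forall_2)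

lemma mat2_sumsI:
  fixes f :: "nat \<Rightarrow> real^2^2"
  assumes "(\<lambda>n. f n $ 1 $ 1) sums (M $ 1 $ 1)" "(\<lambda>n. f n $ 1 $ 2) sums (M $ 1 $ 2)"
    "(\<lambda>n. f n $ 2 $ 1) sums (M $ 2 $ 1)" "(\<lambda>n. f n $ 2 $ 2) sums (M $ 2 $ 2)"
  shows "f sums M"
  unfolding sums_def
proof (rule vec_tendstoI, rule vec_tendstoI)
  fix i j :: 2
  show "(\<lambda>n. sum f {..<n} $ i $ j) \<longlonglongrightarrow> M $ i $ j"
    using exhaust_2[of i] exhaust_2[of j] assms by (auto simp: sums_def)
qed

lemma exp_term_Suc:
  fixes M N :: "real^2^2"
  shows "(1 / fact (Suc n)) *\<^sub>R ((**) M ^^ Suc n) N = (1 / Suc n) *\<^sub>R (M ** ((1 / fact n) *\<^sub>R ((**) M ^^ n) N))"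
  by (simp add: matrix_matrix_mult_def vec_eq_iff sum_2 field_simps del: of_nat_Suc)

text \<open>The exponential series of \<open>k (F - E)\<close> and \<open>a H\<close> are the matrices \<open>K(k)\<close> and \<open>A(a)\<close>.\<close>

lemma exp_matK:
  "(\<lambda>n. (1 / fact n) *\<^sub>R ((**) (k *\<^sub>R (matF - matE)) ^^ n) (mat 1)) sums matK k"
proof -
  have "(1 / fact n) *\<^sub>R ((**) (k *\<^sub>R (matF - matE)) ^^ n) (mat 1)
      = (vector [vector [cos_coeff n *\<^sub>R k ^ n, - (sin_coeff n *\<^sub>R k ^ n)],
                 vector [sin_coeff n *\<^sub>R k ^ n, cos_coeff n *\<^sub>R k ^ n]] :: real^2^2)" for n
  proof (induction n)
    case 0
    show ?case by (rule mat2_eqI) (simp_all add: mat_def)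
  next
    case (Suc n)
    let ?M = "k *\<^sub>R (matF - matE)"
    have "(1 / fact (Suc n)) *\<^sub>R ((**) ?M ^^ Suc n) (mat 1)
        = (1 / Suc n) *\<^sub>R (?M ** ((1 / fact n) *\<^sub>R ((**) ?M ^^ n) (mat 1)))"
      by (rule exp_term_Suc)
    also have "\<dots> = (1 / Suc n) *\<^sub>R (?M ** vector [vector [cos_coeff n *\<^sub>R k ^ n, - (sin_coeff n *\<^sub>R k ^ n)],
                 vector [sin_coeff n *\<^sub>R k ^ n, cos_coeff n *\<^sub>R k ^ n]])"
      by (simp only: Suc.IH)
    finally show ?case
      by (elim ssubst, intro mat2_eqI)
        (simp_all add: matrix_matrix_mult_def sum_2 matE_def matF_def sin_coeff_Suc cos_coeff_Suc
           field_simps)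
  qed
  then show ?thesis
    using sin_converges[of k] cos_converges[of k] sums_minus[OF sin_converges[of k]]
    by (intro mat2_sumsI) (simp_all add: matK_def)
qed

lemma exp_matA:
  "(\<lambda>n. (1 / fact n) *\<^sub>R ((**) (a *\<^sub>R matH) ^^ n) (mat 1)) sums matA a"
proof -
  have "(1 / fact n) *\<^sub>R ((**) (a *\<^sub>R matH) ^^ n) (mat 1)
      = (vector [vector [a ^ n /\<^sub>R fact n, 0], vector [0, (- a) ^ n /\<^sub>R fact n]] :: real^2^2)" for n
  proof (induction n)
    case 0
    show ?case by (rule mat2_eqI) (simp_all add: mat_def)
  next
    case (Suc n)
    let ?M = "a *\<^sub>R matH"
    have "(1 / fact (Suc n)) *\<^sub>R ((**) ?M ^^ Suc n) (mat 1)
        = (1 / Suc n) *\<^sub>R (?M ** ((1 / fact n) *\<^sub>R ((**) ?M ^^ n) (mat 1)))"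
      by (rule exp_term_Suc)
    also have "\<dots> = (1 / Suc n) *\<^sub>R (?M ** vector [vector [a ^ n /\<^sub>R fact n, 0], vector [0, (- a) ^ n /\<^sub>R fact n]])"
      by (simp only: Suc.IH)
    finally show ?case
      by (elim ssubst, intro mat2_eqI)
        (simp_all add: matrix_matrix_mult_def sum_2 matH_def field_simps)
  qed
  then show ?thesis
    using exp_converges[of a] exp_converges[of "- a"]
    by (intro mat2_sumsI) (simp_all add: matA_def)
qed

end

theory Submission
  imports Defs
begin

text \<open>
  In the monomial basis each of the five operators only mixes \<open>z\<^sub>1\<^sup>k\<close> with \<open>z\<^sub>1\<^sup>k z\<^sub>2\<close> and
  \<open>z\<^sub>1\<^sup>k z\<^sub>3\<close> with \<open>z\<^sub>1\<^sup>k z\<^sub>4\<close>, pairs of equal norm.  Exponentiating these \<open>2 \<times> 2\<close> blocks gives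
  a candidate group \<open>V\<close> of bounded operators with locally uniform bounds, so dominated convergence
  makes it strongly continuous.  For any other group \<open>U\<close> with the same generator on polynomials, the
  coefficients of \<open>U(t) V(-t) z\<close> have derivative zero in \<open>t\<close> for every basis vector \<open>z\<close>; hence
  \<open>U(t) V(-t)\<close> is the identity on polynomials and, by boundedness, on the whole Fock space.  The
  formulas are then read off coefficient by coefficient.
\<close>

section \<open>The Hilbert space of coefficient families\<close>

text \<open>A zero of \<open>pochhammer (- \<alpha>) n\<close> would make \<alpha> one of 0, ..., n
  - 1. This is how \<alpha> \<notin> \<nat> enters: every weight is positive, so the norm controls
  every coefficient.\<close>

lemma fock_weight_pos:
  assumes "\<alpha> \<notin> \<nat>"
  shows "0 < fock_weight \<alpha> b"
proof -
  have "pochhammer (- \<alpha>) n \<noteq> 0" for n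
    using assms by (auto simp: pochhammer_eq_0_iff)
  then show ?thesis
    by (cases b; cases "snd b") auto
qed

lemma fock_weight_nonneg: "0 \<le> fock_weight \<alpha> b"
  by (cases b; cases "snd b") auto

text \<open>If \<open>f\<close> is not summable, neither is its complex version, and both sides take
  the default value 0. Hence the real form of the norm below holds for every family, inside the Fock
  space or not.\<close>

lemma infsum_complex_of_real: "(\<Sum>\<^sub>\<infinity>x\<in>A. complex_of_real (f x)) = of_real (infsum f A)"
proof (cases "f summable_on A")
  case True
  then show ?thesis by (intro infsumI) (simp add: has_sum_of_real_iff)
next
  case False
  then have "\<not> (\<lambda>x. complex_of_real (f x)) summable_on A"
    using summable_on_Re by fastforce
  with False show ?thesis by (simp add: infsum_not_exists)
qed

lemma fock_norm_altdef: "fock_norm \<alpha> c = sqrt (\<Sum>\<^sub>\<infinity>b. fock_weight \<alpha> b * (cmod (c b))\<^sup>2)"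
proof -
  have "of_real (fock_weight \<alpha> b) * c b * cnj (c b)
      = of_real (fock_weight \<alpha> b * (cmod (c b))\<^sup>2)" for b
    by (simp add: mult.assoc complex_norm_square flip: of_real_power)
  then show ?thesis
    by (simp add: fock_norm_def fock_inner_def infsum_complex_of_real del: of_real_mult of_real_power)
qed

lemma fock_norm_nonneg: "0 \<le> fock_norm \<alpha> c"
  by (simp add: fock_norm_altdef infsum_nonneg fock_weight_nonneg)

lemma fock_add:
  assumes "c \<in> fock \<alpha>" "d \<in> fock \<alpha>"
  shows "(\<lambda>b. c b + d b) \<in> fock \<alpha>"
proof -
  have "(cmod (c b + d b))\<^sup>2 \<le> 2 * (cmod (c b))\<^sup>2 + 2 * (cmod (d b))\<^sup>2" for b
  proof -
    have "(cmod (c b + d b))\<^sup>2 \<le> (cmod (c b) + cmod (d b))\<^sup>2"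
      by (intro power_mono norm_triangle_ineq) auto
    also have "\<dots> \<le> 2 * (cmod (c b))\<^sup>2 + 2 * (cmod (d b))\<^sup>2"
      using sum_squares_bound[of "cmod (c b)" "cmod (d b)"] by (simp add: power2_sum)
    finally show ?thesis .
  qed
  from mult_left_mono[OF this fock_weight_nonneg]
  have le: "fock_weight \<alpha> b * (cmod (c b + d b))\<^sup>2
      \<le> 2 * (fock_weight \<alpha> b * (cmod (c b))\<^sup>2) + 2 * (fock_weight \<alpha> b * (cmod (d b))\<^sup>2)" for b
    by (simp add: algebra_simps)
  have "(\<lambda>b. 2 * (fock_weight \<alpha> b * (cmod (c b))\<^sup>2) + 2 * (fock_weight \<alpha> b * (cmod (d b))\<^sup>2))
      summable_on UNIV"
    using assms by (intro summable_on_add summable_on_cmult_right) (auto simp: fock_def)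
  then have "(\<lambda>b. fock_weight \<alpha> b * (cmod (c b + d b))\<^sup>2) summable_on UNIV"
    by (rule summable_on_comparison_test) (simp_all add: le fock_weight_nonneg)
  then show ?thesis by (simp add: fock_def)
qed

lemma fock_scale:
  assumes "c \<in> fock \<alpha>"
  shows "(\<lambda>b. s * c b) \<in> fock \<alpha>"
proof -
  have "(\<lambda>b. (cmod s)\<^sup>2 * (fock_weight \<alpha> b * (cmod (c b))\<^sup>2)) summable_on UNIV"
    using assms by (intro summable_on_cmult_right) (auto simp: fock_def)
  then show ?thesis
    by (simp add: fock_def norm_mult power_mult_distrib mult_ac)
qed

lemma fock_diff:
  assumes "c \<in> fock \<alpha>" "d \<in> fock \<alpha>"
  shows "(\<lambda>b. c b - d b) \<in> fock \<alpha>"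
  using fock_add[OF assms(1) fock_scale[OF assms(2), of "- 1"]] by simp

lemma fock_finite_support:
  assumes "finite {b. c b \<noteq> 0}"
  shows "c \<in> fock \<alpha>"
proof -
  have "(\<lambda>b. fock_weight \<alpha> b * (cmod (c b))\<^sup>2) summable_on {b. c b \<noteq> 0}"
    using assms by simp
  also have "?this \<longleftrightarrow> (\<lambda>b. fock_weight \<alpha> b * (cmod (c b))\<^sup>2) summable_on UNIV"
    by (rule summable_on_cong_neutral) auto
  finally show ?thesis by (simp add: fock_def)
qed

text \<open>One term of a nonnegative series is at most its sum. Evaluation of a coefficient is
  therefore continuous for the norm.\<close>

lemma norm_coeff_le_fock_norm:
  assumes "c \<in> fock \<alpha>" and "\<alpha> \<notin> \<nat>"
  shows "cmod (c b) \<le> fock_norm \<alpha> c / sqrt (fock_weight \<alpha> b)"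
proof -
  have "(\<Sum>b\<in>{b}. fock_weight \<alpha> b * (cmod (c b))\<^sup>2) \<le> (\<Sum>\<^sub>\<infinity>b. fock_weight \<alpha> b * (cmod (c b))\<^sup>2)"
    using assms(1) by (intro finite_sum_le_infsum) (auto simp: fock_def fock_weight_nonneg)
  then have "sqrt (fock_weight \<alpha> b * (cmod (c b))\<^sup>2) \<le> fock_norm \<alpha> c"
    unfolding fock_norm_altdef by simp
  then show ?thesis
    using fock_weight_pos[OF assms(2), of b] by (simp add: real_sqrt_mult field_simps)
qed

text \<open>Membership in the Fock space is assumed along with the limit, since
  \<open>fock_norm\<close> takes the default value 0 on families outside it.\<close>

lemma coeff_tendsto_if_fock_norm_tendsto:
  assumes "\<alpha> \<notin> \<nat>"
    and "\<forall>\<^sub>F t in F. (\<lambda>b. x t b - y b) \<in> fock \<alpha>"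
    and "((\<lambda>t. fock_norm \<alpha> (\<lambda>b. x t b - y b)) \<longlongrightarrow> 0) F"
  shows "((\<lambda>t. x t b) \<longlongrightarrow> y b) F"
proof -
  have "((\<lambda>t. x t b - y b) \<longlongrightarrow> 0) F"
  proof (rule Lim_null_comparison)
    show "\<forall>\<^sub>F t in F. cmod (x t b - y b) \<le> fock_norm \<alpha> (\<lambda>b. x t b - y b) / sqrt (fock_weight \<alpha> b)"
      using assms(2) by eventually_elim (rule norm_coeff_le_fock_norm[OF _ assms(1)])
    show "((\<lambda>t. fock_norm \<alpha> (\<lambda>b. x t b - y b) / sqrt (fock_weight \<alpha> b)) \<longlongrightarrow> 0) F"
      using assms(3) by (rule tendsto_divide_zero)
  qed
  then show ?thesis by (rule LIM_zero_cancel)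
qed

text \<open>The squared norm of the tail is the full sum minus a finite partial sum. Finitely
  supported families are thus dense.\<close>

lemma fock_norm_truncation_tendsto_0:
  assumes "c \<in> fock \<alpha>"
  shows "((\<lambda>F. fock_norm \<alpha> (\<lambda>b. (if b \<in> F then c b else 0) - c b)) \<longlongrightarrow> 0) (finite_subsets_at_top UNIV)"
proof -
  let ?f = "\<lambda>b. fock_weight \<alpha> b * (cmod (c b))\<^sup>2"
  have sm: "?f summable_on UNIV" using assms by (simp add: fock_def)
  have "((\<lambda>F. infsum ?f UNIV - sum ?f F) \<longlongrightarrow> infsum ?f UNIV - infsum ?f UNIV) (finite_subsets_at_top UNIV)"
    by (intro tendsto_intros infsum_tendsto sm)
  then have lim: "((\<lambda>F. sqrt (infsum ?f UNIV - sum ?f F)) \<longlongrightarrow> 0) (finite_subsets_at_top UNIV)"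
    using tendsto_real_sqrt by fastforce
  have "sqrt (infsum ?f UNIV - sum ?f F) = fock_norm \<alpha> (\<lambda>b. (if b \<in> F then c b else 0) - c b)"
    if "finite F" for F
  proof -
    have "infsum ?f UNIV = infsum ?f (F \<union> - F)" by simp
    also have "\<dots> = infsum ?f F + infsum ?f (- F)"
      using that sm by (intro infsum_Un_disjoint) (auto intro: summable_on_subset_banach)
    also have "infsum ?f (- F)
        = (\<Sum>\<^sub>\<infinity>b. fock_weight \<alpha> b * (cmod ((if b \<in> F then c b else 0) - c b))\<^sup>2)"
      by (rule infsum_cong_neutral) auto
    finally show ?thesis using that by (simp add: fock_norm_altdef)
  qed
  then have "\<forall>\<^sub>F F in finite_subsets_at_top UNIV.
      sqrt (infsum ?f UNIV - sum ?f F) = fock_norm \<alpha> (\<lambda>b. (if b \<in> F then c b else 0) - c b)"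
    by (intro eventually_finite_subsets_at_top_weakI) auto
  with lim show ?thesis by (rule Lim_transform_eventually)
qed

section \<open>Basis vectors and bounded operators\<close>

definition basis_vec :: "idx \<Rightarrow> idx \<Rightarrow> complex" where
  "basis_vec i = (\<lambda>b. if b = i then 1 else 0)"

lemma basis_vec_fin_coeffs: "basis_vec i \<in> fin_coeffs"
  by (auto simp: basis_vec_def fin_coeffs_def)

lemma fin_coeffs_subset_fock: "fin_coeffs \<subseteq> fock \<alpha>"
  by (auto simp: fin_coeffs_def intro: fock_finite_support)

lemma basis_vec_fock: "basis_vec i \<in> fock \<alpha>"
  using basis_vec_fin_coeffs fin_coeffs_subset_fock by blast

lemma sum_fock:
  assumes "finite F" "\<And>i. i \<in> F \<Longrightarrow> x i \<in> fock \<alpha>"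
  shows "(\<lambda>b. \<Sum>i\<in>F. s i * x i b) \<in> fock \<alpha>"
  using assms by (induction F) (simp_all add: fock_finite_support fock_add fock_scale)

lemma fock_bounded_sum:
  assumes T: "fock_bounded \<alpha> T" and "finite F" "\<And>i. i \<in> F \<Longrightarrow> x i \<in> fock \<alpha>"
  shows "T (\<lambda>b. \<Sum>i\<in>F. s i * x i b) = (\<lambda>b. \<Sum>i\<in>F. s i * T (x i) b)"
  using assms(2,3)
proof (induction F)
  case empty
  \<comment> \<open>The empty sum is 0 times a basis vector, so homogeneity gives its image.\<close>
  have "T (\<lambda>b. 0 * basis_vec (0, G1) b) = (\<lambda>b. 0 * T (basis_vec (0, G1)) b)"
    using T basis_vec_fock unfolding fock_bounded_def by blast
  then show ?case by simp
next
  case (insert i F)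
  have "T (\<lambda>b. s i * x i b + (\<Sum>i\<in>F. s i * x i b))
      = (\<lambda>b. T (\<lambda>b. s i * x i b) b + T (\<lambda>b. \<Sum>i\<in>F. s i * x i b) b)"
    using T fock_scale[of "x i" \<alpha> "s i"] sum_fock[of F x \<alpha> s] insert.hyps insert.prems
    unfolding fock_bounded_def by auto
  also have "T (\<lambda>b. s i * x i b) = (\<lambda>b. s i * T (x i) b)"
    using T insert.prems unfolding fock_bounded_def by blast
  finally show ?case using insert by simp
qed

lemma fock_bounded_add:
  assumes "fock_bounded \<alpha> T" "c \<in> fock \<alpha>" "d \<in> fock \<alpha>"
  shows "T (\<lambda>b. r * c b + s * d b) = (\<lambda>b. r * T c b + s * T d b)"
proof -
  have "T (\<lambda>b. r * c b + s * d b) = (\<lambda>b. T (\<lambda>b. r * c b) b + T (\<lambda>b. s * d b) b)"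
    using assms(1) fock_scale[OF assms(2), of r] fock_scale[OF assms(3), of s]
    unfolding fock_bounded_def by simp
  moreover have "T (\<lambda>b. r * c b) = (\<lambda>b. r * T c b)" "T (\<lambda>b. s * d b) = (\<lambda>b. s * T d b)"
    using assms unfolding fock_bounded_def by blast+
  ultimately show ?thesis by simp
qed

lemma fock_bounded_comp:
  assumes S: "fock_bounded \<alpha> S" and T: "fock_bounded \<alpha> T"
  shows "fock_bounded \<alpha> (\<lambda>c. S (T c))"
proof -
  obtain M where M: "\<And>c. c \<in> fock \<alpha> \<Longrightarrow> fock_norm \<alpha> (S c) \<le> M * fock_norm \<alpha> c"
    using S unfolding fock_bounded_def by blast
  obtain N where N: "\<And>c. c \<in> fock \<alpha> \<Longrightarrow> fock_norm \<alpha> (T c) \<le> N * fock_norm \<alpha> c"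
    using T unfolding fock_bounded_def by blast
  have T_fock: "T c \<in> fock \<alpha>" if "c \<in> fock \<alpha>" for c
    using T that unfolding fock_bounded_def by blast
  \<comment> \<open>\<open>fock_bounded\<close> puts no sign condition on its constant; with the
    absolute value the second estimate may be multiplied by the first.\<close>
  have "fock_norm \<alpha> (S (T c)) \<le> (\<bar>M\<bar> * N) * fock_norm \<alpha> c" if c: "c \<in> fock \<alpha>" for c
  proof -
    have "fock_norm \<alpha> (S (T c)) \<le> \<bar>M\<bar> * fock_norm \<alpha> (T c)"
      using M[OF T_fock[OF c]] mult_right_mono[OF abs_ge_self[of M] fock_norm_nonneg[of \<alpha> "T c"]]
      by linarith
    also have "\<dots> \<le> \<bar>M\<bar> * (N * fock_norm \<alpha> c)"
      by (intro mult_left_mono N c) auto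
    finally show ?thesis by (simp add: mult.assoc)
  qed
  moreover have "S (T (\<lambda>b. c b + d b)) = (\<lambda>b. S (T c) b + S (T d) b)"
    if "c \<in> fock \<alpha>" "d \<in> fock \<alpha>" for c d
    using fock_bounded_add[OF T that, of 1 1] fock_bounded_add[OF S T_fock T_fock, OF that, of 1 1]
    by simp
  moreover have "S (T (\<lambda>b. s * c b)) = (\<lambda>b. s * S (T c) b)" if "c \<in> fock \<alpha>" for c s
    using S T T_fock[OF that] that unfolding fock_bounded_def by metis
  moreover have "S (T c) \<in> fock \<alpha>" if "c \<in> fock \<alpha>" for c
    using S T_fock[OF that] unfolding fock_bounded_def by blast
  ultimately show ?thesis
    unfolding fock_bounded_def by blast
qed

text \<open>A bounded operator followed by a coefficient evaluation is continuous. The filter is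
  arbitrary because the limit is taken both along finite truncations and along difference quotients
  at time 0.\<close>

lemma fock_bounded_coeff_tendsto:
  assumes "\<alpha> \<notin> \<nat>" and T: "fock_bounded \<alpha> T" and y: "y \<in> fock \<alpha>"
    and x: "\<forall>\<^sub>F t in F. x t \<in> fock \<alpha>"
    and lim: "((\<lambda>t. fock_norm \<alpha> (\<lambda>b. x t b - y b)) \<longlongrightarrow> 0) F"
  shows "((\<lambda>t. T (x t) b) \<longlongrightarrow> T y b) F"
proof -
  obtain M where M: "\<And>c. c \<in> fock \<alpha> \<Longrightarrow> fock_norm \<alpha> (T c) \<le> M * fock_norm \<alpha> c"
    using T unfolding fock_bounded_def by blast
  have diff: "(\<lambda>b. T c b - T y b) = T (\<lambda>b. c b - y b)" if "c \<in> fock \<alpha>" for c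
    using fock_bounded_add[OF T that y, of 1 "- 1"] by simp
  have T_fock: "T c \<in> fock \<alpha>" if "c \<in> fock \<alpha>" for c
    using T that unfolding fock_bounded_def by blast
  show ?thesis
  proof (rule coeff_tendsto_if_fock_norm_tendsto[OF assms(1)])
    show "\<forall>\<^sub>F t in F. (\<lambda>b. T (x t) b - T y b) \<in> fock \<alpha>"
      using x by eventually_elim (simp add: fock_diff T_fock y)
    show "((\<lambda>t. fock_norm \<alpha> (\<lambda>b. T (x t) b - T y b)) \<longlongrightarrow> 0) F"
    proof (rule Lim_null_comparison)
      show "\<forall>\<^sub>F t in F. norm (fock_norm \<alpha> (\<lambda>b. T (x t) b - T y b)) \<le> M * fock_norm \<alpha> (\<lambda>b. x t b - y b)"
        using x
      proof eventually_elim
        case (elim t)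
        then show ?case
          using M[OF fock_diff[OF elim y]] by (simp add: diff[OF elim] fock_norm_nonneg)
      qed
      show "((\<lambda>t. M * fock_norm \<alpha> (\<lambda>b. x t b - y b)) \<longlongrightarrow> 0) F"
        using lim by (rule tendsto_mult_right_zero)
    qed
  qed
qed

text \<open>Apply \<open>T\<close> to the finite truncations of \<open>c\<close>, which converge to
  \<open>c\<close> in norm. A bounded operator is thus determined by its values on basis
  vectors.\<close>

lemma fock_bounded_has_sum:
  assumes "\<alpha> \<notin> \<nat>" and T: "fock_bounded \<alpha> T" and c: "c \<in> fock \<alpha>"
  shows "((\<lambda>i. c i * T (basis_vec i) b) has_sum T c b) UNIV"
proof -
  have fin: "(\<lambda>b. if b \<in> F then c b else 0) = (\<lambda>b. \<Sum>i\<in>F. c i * basis_vec i b)" if "finite F" for F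
    using that by (auto simp: basis_vec_def if_distrib sum.delta cong: if_cong)
  have "((\<lambda>F. T (\<lambda>b. if b \<in> F then c b else 0) b) \<longlongrightarrow> T c b) (finite_subsets_at_top UNIV)"
    by (intro fock_bounded_coeff_tendsto[OF assms] fock_norm_truncation_tendsto_0[OF c]
        eventually_finite_subsets_at_top_weakI) (auto intro: fock_finite_support)
  moreover have "\<forall>\<^sub>F F in finite_subsets_at_top UNIV.
      T (\<lambda>b. if b \<in> F then c b else 0) b = (\<Sum>i\<in>F. c i * T (basis_vec i) b)"
    by (intro eventually_finite_subsets_at_top_weakI)
      (simp add: fin fock_bounded_sum[OF T] basis_vec_fock)
  ultimately show ?thesis
    unfolding has_sum_def by (rule Lim_transform_eventually)
qed

lemma fock_bounded_eqI:
  assumes "\<alpha> \<notin> \<nat>" "fock_bounded \<alpha> S" "fock_bounded \<alpha> T"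
    and "\<And>i. S (basis_vec i) = T (basis_vec i)" and "c \<in> fock \<alpha>"
  shows "S c = T c"
proof
  fix b
  show "S c b = T c b"
    using fock_bounded_has_sum[OF assms(1,2,5), of b] fock_bounded_has_sum[OF assms(1,3,5), of b]
    unfolding assms(4) by (rule has_sum_unique)
qed


section \<open>One-parameter groups in blocks of size two\<close>

text \<open>By the Weierstrass test the partial sums converge uniformly on [-1, 1], so the limit may
  be exchanged with the sum. As 0 is interior to the interval, restricting to it does not change the
  limit.\<close>

lemma infsum_tendsto_0_dominated:
  fixes f :: "real \<Rightarrow> 'b \<Rightarrow> real"
  assumes bound: "\<And>t b. \<bar>t\<bar> \<le> 1 \<Longrightarrow> \<bar>f t b\<bar> \<le> M b" and "M summable_on UNIV"
    and lim: "\<And>b. ((\<lambda>t. f t b) \<longlongrightarrow> 0) (at 0)"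
  shows "((\<lambda>t. \<Sum>\<^sub>\<infinity>b. f t b) \<longlongrightarrow> 0) (at 0)"
proof -
  have at: "at (0::real) within {-1..1} = at 0"
    by (rule at_within_interior) simp
  have "((\<lambda>t. \<Sum>\<^sub>\<infinity>b. f t b) \<longlongrightarrow> 0) (at 0 within {-1..1})"
  proof (rule swap_uniform_limit)
    show "uniform_limit {-1..1} (\<lambda>B t. \<Sum>b\<in>B. f t b) (\<lambda>t. \<Sum>\<^sub>\<infinity>b. f t b) (finite_subsets_at_top UNIV)"
      using assms(2) by (intro Weierstrass_m_test_general) (auto intro: bound)
    show "\<forall>\<^sub>F B in finite_subsets_at_top UNIV. ((\<lambda>t. \<Sum>b\<in>B. f t b) \<longlongrightarrow> (\<Sum>b\<in>B. 0)) (at 0 within {-1..1})"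
      unfolding at by (intro always_eventually allI tendsto_sum lim)
  qed auto
  then show ?thesis unfolding at .
qed

text \<open>The partner of an index in its block. Partners have equal weight, so exchanging them is
  an isometry.\<close>

fun swap_gen :: "idx \<Rightarrow> idx" where
  "swap_gen (k, G1) = (k, Gz2)"
| "swap_gen (k, Gz2) = (k, G1)"
| "swap_gen (k, Gz3) = (k, Gz4)"
| "swap_gen (k, Gz4) = (k, Gz3)"

lemma swap_gen_swap_gen [simp]: "swap_gen (swap_gen b) = b"
  by (cases b rule: swap_gen.cases) auto

lemma fock_weight_swap_gen [simp]: "fock_weight \<alpha> (swap_gen b) = fock_weight \<alpha> b"
  by (cases b rule: swap_gen.cases) auto

lemma swap_gen_eq_iff: "swap_gen a = b \<longleftrightarrow> a = swap_gen b"
  by auto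

lemma bij_swap_gen: "bij swap_gen"
  by (rule o_bij[of swap_gen]) auto

lemma fock_swap_gen:
  assumes "c \<in> fock \<alpha>"
  shows "(\<lambda>b. c (swap_gen b)) \<in> fock \<alpha>"
  using assms summable_on_reindex_bij_betw[OF bij_swap_gen, of "\<lambda>b. fock_weight \<alpha> b * (cmod (c b))\<^sup>2"]
  by (simp add: fock_def)

section \<open>Coordinates of polynomials and operators in blocks of size two\<close>

lemma coords_of_coeffs: "c \<in> fin_coeffs \<Longrightarrow> coords (of_coeffs c) = c"
  using bij_betw_of_coeffs unfolding coords_def bij_betw_def by (auto intro: inv_into_f_f)

lemma coords_fin_coeffs: "coords v \<in> fin_coeffs"
  using bij_betw_of_coeffs unfolding coords_def bij_betw_def by (auto intro: inv_into_into)

text \<open>\<open>p b\<close> is the diagonal entry of row \<open>b\<close>, and \<open>q b\<close>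
  is the entry in row \<open>b\<close> and column \<open>swap_gen b\<close>.\<close>

definition block_op :: "(idx \<Rightarrow> complex) \<Rightarrow> (idx \<Rightarrow> complex) \<Rightarrow> (idx \<Rightarrow> complex) \<Rightarrow> idx \<Rightarrow> complex" where
  "block_op p q c = (\<lambda>b. p b * c b + q b * c (swap_gen b))"

text \<open>Uses (x + y)^2 \<le> 2 x^2 + 2 y^2 and the equal weights of partners. The right side
  depends on \<open>p\<close> and \<open>q\<close> only through \<open>M\<close>, so it also
  dominates a whole range of times uniformly.\<close>

lemma block_op_bound:
  assumes "cmod (p b) \<le> M" "cmod (q b) \<le> M"
  shows "fock_weight \<alpha> b * (cmod (block_op p q c b))\<^sup>2
    \<le> 2 * M\<^sup>2 * (fock_weight \<alpha> b * (cmod (c b))\<^sup>2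
        + fock_weight \<alpha> (swap_gen b) * (cmod (c (swap_gen b)))\<^sup>2)"
proof -
  let ?x = "cmod (c b)" and ?y = "cmod (c (swap_gen b))"
  have "cmod (block_op p q c b) \<le> cmod (p b) * ?x + cmod (q b) * ?y"
    unfolding block_op_def by (metis norm_mult norm_triangle_ineq)
  also have "\<dots> \<le> M * ?x + M * ?y"
    using assms by (intro add_mono mult_right_mono) auto
  finally have "(cmod (block_op p q c b))\<^sup>2 \<le> (M * ?x + M * ?y)\<^sup>2"
    by (intro power_mono) auto
  also have "\<dots> = M\<^sup>2 * (?x + ?y)\<^sup>2"
    by (simp add: power_mult_distrib flip: distrib_left)
  also have "\<dots> \<le> M\<^sup>2 * (2 * ?x\<^sup>2 + 2 * ?y\<^sup>2)"
    using sum_squares_bound[of ?x ?y] by (intro mult_left_mono) (auto simp: power2_sum)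
  finally have "fock_weight \<alpha> b * (cmod (block_op p q c b))\<^sup>2
      \<le> fock_weight \<alpha> b * (M\<^sup>2 * (2 * ?x\<^sup>2 + 2 * ?y\<^sup>2))"
    by (intro mult_left_mono fock_weight_nonneg)
  then show ?thesis by (simp add: algebra_simps)
qed

lemma block_op_summable:
  assumes "c \<in> fock \<alpha>"
  shows "(\<lambda>b. K * (fock_weight \<alpha> b * (cmod (c b))\<^sup>2
        + fock_weight \<alpha> (swap_gen b) * (cmod (c (swap_gen b)))\<^sup>2)) summable_on UNIV"
  using assms fock_swap_gen[OF assms]
  by (intro summable_on_cmult_right summable_on_add) (auto simp: fock_def)

lemma fock_bounded_block_op:
  assumes M: "\<And>b. cmod (p b) \<le> M" "\<And>b. cmod (q b) \<le> M"
  shows "fock_bounded \<alpha> (block_op p q)"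
  unfolding fock_bounded_def
proof (intro conjI ballI allI exI)
  fix c assume c: "c \<in> fock \<alpha>"
  let ?f = "\<lambda>b. fock_weight \<alpha> b * (cmod (c b))\<^sup>2"
  note sm = block_op_summable[OF c, of "2 * M\<^sup>2"]
  show T: "block_op p q c \<in> fock \<alpha>"
    using summable_on_comparison_test[OF sm block_op_bound[OF M]]
    by (simp add: fock_def fock_weight_nonneg)
  show "block_op p q (\<lambda>b. s * c b) = (\<lambda>b. s * block_op p q c b)" for s
    by (simp add: block_op_def algebra_simps)
  have f: "?f summable_on UNIV" and f': "(\<lambda>b. ?f (swap_gen b)) summable_on UNIV"
    using c fock_swap_gen[OF c] by (auto simp: fock_def)
  have "(\<Sum>\<^sub>\<infinity>b. fock_weight \<alpha> b * (cmod (block_op p q c b))\<^sup>2)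
      \<le> (\<Sum>\<^sub>\<infinity>b. 2 * M\<^sup>2 * (?f b + ?f (swap_gen b)))"
    using T sm by (intro infsum_mono block_op_bound M) (auto simp: fock_def)
  also have "\<dots> = 2 * M\<^sup>2 * ((\<Sum>\<^sub>\<infinity>b. ?f b) + (\<Sum>\<^sub>\<infinity>b. ?f (swap_gen b)))"
    by (simp only: infsum_cmult_right[OF summable_on_add[OF f f']] infsum_add[OF f f'])
  \<comment> \<open>Reindexing makes the two sums equal, and the square root turns
    \<open>4 * M\<^sup>2\<close> into the operator bound \<open>\<bar>2 * M\<bar>\<close>.\<close>
  also have "(\<Sum>\<^sub>\<infinity>b. ?f (swap_gen b)) = (\<Sum>\<^sub>\<infinity>b. ?f b)"
    by (rule infsum_reindex_bij_betw[OF bij_swap_gen])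
  finally have "fock_norm \<alpha> (block_op p q c) \<le> sqrt ((2 * M)\<^sup>2 * (\<Sum>\<^sub>\<infinity>b. ?f b))"
    by (simp add: fock_norm_altdef power_mult_distrib)
  then show "fock_norm \<alpha> (block_op p q c) \<le> \<bar>2 * M\<bar> * fock_norm \<alpha> c"
    by (simp only: real_sqrt_mult real_sqrt_abs fock_norm_altdef)
next
  fix c d
  show "block_op p q (\<lambda>b. c b + d b) = (\<lambda>b. block_op p q c b + block_op p q d b)"
    by (simp add: block_op_def algebra_simps)
qed

text \<open>Dividing the remainder by t translates between the derivative and the difference
  quotients used in \<open>generated_by\<close>.\<close>

lemma has_vector_derivative_at_0_iff:
  "(f has_vector_derivative d) (at 0) \<longleftrightarrow> ((\<lambda>t. (f t - f 0) /\<^sub>R t) \<longlongrightarrow> d) (at 0)"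
proof -
  have "norm (f t - f 0 - t *\<^sub>R d) / \<bar>t\<bar> = norm ((f t - f 0) /\<^sub>R t - d)" if "t \<noteq> 0" for t
  proof -
    have "f t - f 0 - t *\<^sub>R d = t *\<^sub>R ((f t - f 0) /\<^sub>R t - d)"
      using that by (simp add: scaleR_diff_right)
    then show ?thesis using that by (simp only: norm_scaleR) simp
  qed
  then have "((\<lambda>t. norm (f t - f 0 - t *\<^sub>R d) / \<bar>t\<bar>) \<longlongrightarrow> 0) (at 0) \<longleftrightarrow>
      ((\<lambda>t. norm ((f t - f 0) /\<^sub>R t - d)) \<longlongrightarrow> 0) (at 0)"
    by (intro filterlim_cong refl) (auto simp: eventually_at_filter)
  then show ?thesis
    by (simp add: has_vector_derivative_def has_derivative_at bounded_linear_scaleR_left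
        tendsto_norm_zero_iff LIM_zero_iff)
qed

text \<open>Together with a group law this carries a derivative at time 0 to any time.\<close>

lemma has_vector_derivative_shift_0:
  assumes "((\<lambda>s. f (s + t)) has_vector_derivative d) (at 0)"
  shows "(f has_vector_derivative d) (at t)"
proof -
  have "((\<lambda>u. u - t) has_vector_derivative 1) (at t)"
    by (auto intro!: derivative_eq_intros)
  from vector_diff_chain_at[OF this, of "\<lambda>s. f (s + t)" d] show ?thesis
    using assms by (simp add: o_def)
qed

lemma has_vector_derivative_reflect:
  assumes "(f has_vector_derivative d) (at (- t))"
  shows "((\<lambda>t. f (- t)) has_vector_derivative - d) (at t)"
proof -
  have "((\<lambda>u. - u) has_vector_derivative - 1) (at t)"
    by (auto intro!: derivative_eq_intros)
  from vector_diff_chain_at[OF this assms] show ?thesis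
    by (simp add: o_def)
qed

text \<open>\<open>p_add\<close> and \<open>q_add\<close> are the matrix product of two blocks, and
  \<open>p'\<close>, \<open>q'\<close> are the entries of the generator. The constant in
  \<open>locally_bounded\<close> is uniform over the infinitely many blocks; boundedness and strong
  continuity rest on it.\<close>

locale block_group =
  fixes p q :: "real \<Rightarrow> idx \<Rightarrow> complex" and p' q' :: "idx \<Rightarrow> complex"
  assumes p_0: "p 0 b = 1" and q_0: "q 0 b = 0"
    and p_add: "p (s + t) b = p s b * p t b + q s b * q t (swap_gen b)"
    and q_add: "q (s + t) b = p s b * q t b + q s b * p t (swap_gen b)"
    and p_deriv: "((\<lambda>t. p t b) has_vector_derivative p' b) (at 0)"
    and q_deriv: "((\<lambda>t. q t b) has_vector_derivative q' b) (at 0)"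
    and locally_bounded: "\<exists>M. \<forall>t b. \<bar>t\<bar> \<le> r \<longrightarrow> cmod (p t b) \<le> M \<and> cmod (q t b) \<le> M"
begin

abbreviation V :: "real \<Rightarrow> (idx \<Rightarrow> complex) \<Rightarrow> idx \<Rightarrow> complex" where
  "V t \<equiv> block_op (p t) (q t)"

lemma fock_bounded_V: "fock_bounded \<alpha> (V t)"
proof -
  obtain M where "\<And>b. cmod (p t b) \<le> M" "\<And>b. cmod (q t b) \<le> M"
    using locally_bounded[of "\<bar>t\<bar>"] by blast
  then show ?thesis by (rule fock_bounded_block_op)
qed

text \<open>\<open>V t\<close> minus the identity is again a block operator, with \<open>p t\<close>
  replaced by \<open>p t - 1\<close>. Its entries tend to 0, and for
  \<open>\<bar>t\<bar> \<le> 1\<close> they are uniformly bounded, so dominated convergence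
  applies.\<close>

lemma V_strongly_continuous:
  assumes c: "c \<in> fock \<alpha>"
  shows "((\<lambda>t. fock_norm \<alpha> (\<lambda>b. V t c b - c b)) \<longlongrightarrow> 0) (at 0)"
proof -
  obtain M where M: "\<And>t b. \<bar>t\<bar> \<le> 1 \<Longrightarrow> cmod (p t b) \<le> M" "\<And>t b. \<bar>t\<bar> \<le> 1 \<Longrightarrow> cmod (q t b) \<le> M"
    using locally_bounded[of 1] by blast
  have eq: "(\<lambda>b. V t c b - c b) = block_op (\<lambda>b. p t b - 1) (q t) c" for t
    by (simp add: block_op_def algebra_simps)
  have M': "cmod (p t b - 1) \<le> M + 1" "cmod (q t b) \<le> M + 1" if "\<bar>t\<bar> \<le> 1" for t b
    using M[OF that, of b] norm_triangle_ineq4[of "p t b" 1] by auto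
  have "((\<lambda>t. \<Sum>\<^sub>\<infinity>b. fock_weight \<alpha> b * (cmod (block_op (\<lambda>b. p t b - 1) (q t) c b))\<^sup>2) \<longlongrightarrow> 0) (at 0)"
  proof (rule infsum_tendsto_0_dominated)
    show "\<bar>fock_weight \<alpha> b * (cmod (block_op (\<lambda>b. p t b - 1) (q t) c b))\<^sup>2\<bar>
        \<le> 2 * (M + 1)\<^sup>2 * (fock_weight \<alpha> b * (cmod (c b))\<^sup>2
        + fock_weight \<alpha> (swap_gen b) * (cmod (c (swap_gen b)))\<^sup>2)" if "\<bar>t\<bar> \<le> 1" for t b
      using block_op_bound[OF M'[OF that], where \<alpha> = \<alpha> and c = c] by (simp add: fock_weight_nonneg)
    show "((\<lambda>t. fock_weight \<alpha> b * (cmod (block_op (\<lambda>b. p t b - 1) (q t) c b))\<^sup>2) \<longlongrightarrow> 0) (at 0)" for b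
    proof -
      have "((\<lambda>t. p t b) \<longlongrightarrow> p 0 b) (at 0)" "((\<lambda>t. q t b) \<longlongrightarrow> q 0 b) (at 0)"
        using has_vector_derivative_continuous[OF p_deriv] has_vector_derivative_continuous[OF q_deriv]
        by (auto simp: continuous_within)
      then have "((\<lambda>t. fock_weight \<alpha> b * (cmod ((p t b - 1) * c b + q t b * c (swap_gen b)))\<^sup>2)
          \<longlongrightarrow> fock_weight \<alpha> b * (cmod ((1 - 1) * c b + 0 * c (swap_gen b)))\<^sup>2) (at 0)"
        unfolding p_0 q_0 by (intro tendsto_intros)
      then show ?thesis by (simp add: block_op_def)
    qed
  qed (rule block_op_summable[OF c])
  then show ?thesis
    unfolding eq fock_norm_altdef using tendsto_real_sqrt by fastforce
qed

lemma V_add: "V (s + t) c = V s (V t c)"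
  by (rule ext) (simp only: block_op_def p_add q_add swap_gen_swap_gen ring_distribs ac_simps)

lemma V_0: "V 0 c = c"
  by (simp add: block_op_def p_0 q_0)

lemma fock_group_V: "fock_group \<alpha> V"
  unfolding fock_group_def
  by (intro conjI allI ballI fock_bounded_V V_strongly_continuous V_0 V_add)

lemma generated_by_V:
  assumes A: "\<And>v. coords (A v) = block_op p' q' (coords v)"
  shows "generated_by \<alpha> V A"
  unfolding generated_by_def
proof
  fix v
  define c where "c = coords v"
  let ?d = "\<lambda>t b. (V t c b - c b) / of_real t - block_op p' q' c b"
  \<comment> \<open>\<open>F\<close> is closed under \<open>swap_gen\<close> and independent of t.
    It supports every difference quotient, so the norm is a finite sum and convergence of each
    coefficient suffices.\<close>
  define F where "F = {b. c b \<noteq> 0} \<union> swap_gen ` {b. c b \<noteq> 0}"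
  have F: "finite F"
    using coords_fin_coeffs[of v] by (simp add: F_def c_def fin_coeffs_def)
  have "b \<in> F" if "?d t b \<noteq> 0" for t b
  proof (rule ccontr)
    assume "b \<notin> F"
    then have "c b = 0" "c (swap_gen b) = 0"
      unfolding F_def by auto (metis (mono_tags) imageI mem_Collect_eq swap_gen_swap_gen)
    with that show False by (simp add: block_op_def)
  qed
  then have "(\<Sum>\<^sub>\<infinity>b. fock_weight \<alpha> b * (cmod (?d t b))\<^sup>2)
      = infsum (\<lambda>b. fock_weight \<alpha> b * (cmod (?d t b))\<^sup>2) F" for t
    by (intro infsum_cong_neutral) auto
  then have norm: "fock_norm \<alpha> (?d t) = sqrt (\<Sum>b\<in>F. fock_weight \<alpha> b * (cmod (?d t b))\<^sup>2)" for t
    using F by (simp add: fock_norm_altdef)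
  have d: "((\<lambda>t. ?d t b) \<longlongrightarrow> 0) (at 0)" for b
  proof -
    have "((\<lambda>t. (p t b - 1) /\<^sub>R t) \<longlongrightarrow> p' b) (at 0)" "((\<lambda>t. q t b /\<^sub>R t) \<longlongrightarrow> q' b) (at 0)"
      using p_deriv[of b] q_deriv[of b] by (simp_all add: has_vector_derivative_at_0_iff p_0 q_0)
    then have "((\<lambda>t. (p t b - 1) /\<^sub>R t * c b + q t b /\<^sub>R t * c (swap_gen b) - block_op p' q' c b)
        \<longlongrightarrow> p' b * c b + q' b * c (swap_gen b) - block_op p' q' c b) (at 0)"
      by (intro tendsto_intros)
    then show ?thesis
      by (simp add: block_op_def scaleR_conv_of_real divide_inverse algebra_simps)
  qed
  have "((\<lambda>t. fock_norm \<alpha> (?d t)) \<longlongrightarrow> sqrt (\<Sum>b\<in>F. fock_weight \<alpha> b * (cmod 0)\<^sup>2)) (at 0)"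
    unfolding norm by (intro tendsto_real_sqrt tendsto_sum tendsto_mult tendsto_const tendsto_power tendsto_norm d)
  then show "((\<lambda>t. fock_norm \<alpha> (\<lambda>b. (V t (coords v) b - coords v b) / of_real t - coords (A v) b)) \<longlongrightarrow> 0) (at 0)"
    by (simp add: A c_def)
qed

text \<open>This is column \<open>i\<close> of the block; as \<open>q\<close> is indexed by rows,
  its off-diagonal entry is \<open>q t (swap_gen i)\<close>.\<close>

lemma V_basis_vec:
  "V t (basis_vec i) = (\<lambda>b. p t i * basis_vec i b + q t (swap_gen i) * basis_vec (swap_gen i) b)"
  by (auto simp: block_op_def basis_vec_def swap_gen_eq_iff)

text \<open>Differentiating the addition law in its first argument at 0 gives V' = A V, with the
  generator on the left.\<close>

lemma p_has_vector_derivative: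
  "((\<lambda>t. p t b) has_vector_derivative p' b * p t b + q' b * q t (swap_gen b)) (at t)"
proof -
  have "((\<lambda>s. p s b * p t b + q s b * q t (swap_gen b)) has_vector_derivative
      p' b * p t b + q' b * q t (swap_gen b)) (at 0)"
    by (intro has_vector_derivative_add has_vector_derivative_mult_left p_deriv q_deriv)
  then show ?thesis
    unfolding p_add[symmetric] by (rule has_vector_derivative_shift_0)
qed

lemma q_has_vector_derivative:
  "((\<lambda>t. q t b) has_vector_derivative p' b * q t b + q' b * p t (swap_gen b)) (at t)"
proof -
  have "((\<lambda>s. p s b * q t b + q s b * p t (swap_gen b)) has_vector_derivative
      p' b * q t b + q' b * p t (swap_gen b)) (at 0)"
    by (intro has_vector_derivative_add has_vector_derivative_mult_left p_deriv q_deriv)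
  then show ?thesis
    unfolding q_add[symmetric] by (rule has_vector_derivative_shift_0)
qed

section \<open>Uniqueness of the group with the given generator on polynomials\<close>

context
  fixes \<alpha> :: real and U A
  assumes \<alpha>: "\<alpha> \<notin> \<nat>" and U: "fock_group \<alpha> U" and gen: "generated_by \<alpha> U A"
    and A: "\<And>v. coords (A v) = block_op p' q' (coords v)"
begin

lemma fock_bounded_U: "fock_bounded \<alpha> (U t)"
  using U by (simp add: fock_group_def)

text \<open>Here U' = U A on basis vectors, with the generator on the right: the bounded operator
  \<open>U t\<close> is applied to the difference quotient at time 0. Since A maps a basis vector
  into the span of its block, the system is closed.\<close>

lemma U_basis_vec_has_vector_derivative:
  "((\<lambda>t. U t (basis_vec i) b) has_vector_derivative
     p' i * U t (basis_vec i) b + q' (swap_gen i) * U t (basis_vec (swap_gen i)) b) (at t)"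
proof -
  let ?e = "basis_vec i"
  let ?Ae = "\<lambda>b. p' i * ?e b + q' (swap_gen i) * basis_vec (swap_gen i) b"
  \<comment> \<open>The difference quotient as a linear combination, the form to which linearity of
    \<open>U t\<close> applies.\<close>
  let ?x = "\<lambda>s b. (1 / of_real s) * U s ?e b + (- 1 / of_real s) * ?e b"
  have coords_e: "coords (of_coeffs ?e) = ?e"
    by (rule coords_of_coeffs[OF basis_vec_fin_coeffs])
  have Ae: "coords (A (of_coeffs ?e)) = ?Ae"
    unfolding A coords_e by (auto simp: block_op_def basis_vec_def swap_gen_eq_iff)
  have Us: "U s ?e \<in> fock \<alpha>" for s
    using fock_bounded_U basis_vec_fock unfolding fock_bounded_def by blast
  have "((\<lambda>s. fock_norm \<alpha> (\<lambda>b. (U s ?e b - ?e b) / of_real s - ?Ae b)) \<longlongrightarrow> 0) (at 0)"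
    using gen[unfolded generated_by_def, rule_format, of "of_coeffs ?e"] by (simp only: Ae coords_e)
  also have "(\<lambda>s b. (U s ?e b - ?e b) / of_real s - ?Ae b) = (\<lambda>s b. ?x s b - ?Ae b)"
    by (simp add: diff_divide_distrib)
  finally have lim: "((\<lambda>s. fock_norm \<alpha> (\<lambda>b. ?x s b - ?Ae b)) \<longlongrightarrow> 0) (at 0)" .
  have "?x s \<in> fock \<alpha>" for s
    by (rule fock_add[OF fock_scale[OF Us] fock_scale[OF basis_vec_fock]])
  moreover have "?Ae \<in> fock \<alpha>"
    by (rule fock_add[OF fock_scale[OF basis_vec_fock] fock_scale[OF basis_vec_fock]])
  ultimately have "((\<lambda>s. U t (?x s) b) \<longlongrightarrow> U t ?Ae b) (at 0)"
    using lim by (intro fock_bounded_coeff_tendsto[OF \<alpha> fock_bounded_U]) auto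
  also have "U t ?Ae = (\<lambda>b. p' i * U t ?e b + q' (swap_gen i) * U t (basis_vec (swap_gen i)) b)"
    by (intro fock_bounded_add[OF fock_bounded_U] basis_vec_fock)
  \<comment> \<open>The equation also holds at s = 0, where division by zero makes both sides
    0.\<close>
  also have "(\<lambda>s. U t (?x s) b) = (\<lambda>s. (U (s + t) ?e b - U t ?e b) /\<^sub>R s)"
  proof
    fix s
    have "U t (?x s) = (\<lambda>b. (1 / of_real s) * U t (U s ?e) b + (- 1 / of_real s) * U t ?e b)"
      by (intro fock_bounded_add[OF fock_bounded_U] basis_vec_fock Us)
    moreover have "U t (U s ?e) = U (s + t) ?e"
      using U basis_vec_fock unfolding fock_group_def by (metis add.commute)
    ultimately show "U t (?x s) b = (U (s + t) ?e b - U t ?e b) /\<^sub>R s"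
      by (simp add: scaleR_conv_of_real divide_inverse algebra_simps)
  qed
  finally have "((\<lambda>s. U (s + t) ?e b) has_vector_derivative
     p' i * U t ?e b + q' (swap_gen i) * U t (basis_vec (swap_gen i)) b) (at 0)"
    by (simp add: has_vector_derivative_at_0_iff)
  then show ?thesis
    by (rule has_vector_derivative_shift_0)
qed

text \<open>\<open>?F\<close> is coefficient \<open>b\<close> of U(t) V(-t) applied to a basis
  vector. With U' = U A and V' = A V, the product rule gives U A V - U A V = 0, and no commutation
  of U with A has to be known.\<close>

lemma U_V_basis_vec: "U t (V (- t) (basis_vec i)) = basis_vec i"
proof
  fix b
  let ?g = "\<lambda>i t. U t (basis_vec i) b"
  let ?F = "\<lambda>t. p (- t) i * ?g i t + q (- t) (swap_gen i) * ?g (swap_gen i) t"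
  have F': "(?F has_vector_derivative 0) (at t)" for t
    by (rule has_vector_derivative_eq_rhs[OF has_vector_derivative_add[OF
          has_vector_derivative_mult[OF has_vector_derivative_reflect[OF p_has_vector_derivative]
            U_basis_vec_has_vector_derivative]
          has_vector_derivative_mult[OF has_vector_derivative_reflect[OF q_has_vector_derivative]
            U_basis_vec_has_vector_derivative]]])
      (simp add: algebra_simps)
  obtain k where k: "\<And>t. ?F t = k"
    using has_vector_derivative_zero_constant[of UNIV ?F] F' by auto
  have "?F t = ?F 0"
    using k[of t] k[of 0] by simp
  also have "?F 0 = basis_vec i b"
    using U basis_vec_fock by (simp add: p_0 q_0 fock_group_def)
  finally show "U t (V (- t) (basis_vec i)) b = basis_vec i b"
    by (simp add: V_basis_vec fock_bounded_add[OF fock_bounded_U basis_vec_fock basis_vec_fock])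
qed

lemma U_eq_V:
  assumes c: "c \<in> fock \<alpha>"
  shows "U t c = V t c"
proof -
  have V_fock: "V t c \<in> fock \<alpha>" if "c \<in> fock \<alpha>" for t c
    using fock_bounded_V that unfolding fock_bounded_def by blast
  \<comment> \<open>U(t) V(-t) and the identity are bounded and agree on basis vectors, so they
    agree on \<open>V t c\<close>; then V(-t) V(t) cancels.\<close>
  have "U t (V (- t) (V t c)) = V t c"
  proof (rule fock_bounded_eqI[OF \<alpha>, of "\<lambda>c. U t (V (- t) c)" "\<lambda>c. c"])
    show "fock_bounded \<alpha> (\<lambda>c. U t (V (- t) c))"
      by (rule fock_bounded_comp[OF fock_bounded_U fock_bounded_V])
    show "fock_bounded \<alpha> (\<lambda>c. c)"
      unfolding fock_bounded_def by (auto intro: exI[of _ 1])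
  qed (simp_all add: U_V_basis_vec V_fock c)
  then show ?thesis
    by (simp add: V_0 flip: V_add)
qed

end

text \<open>\<open>V\<close> provides existence for the definite description, and
  \<open>U_eq_V\<close> provides uniqueness.\<close>

lemma op_exp_eq:
  assumes "\<alpha> \<notin> \<nat>" and A: "\<And>v. coords (A v) = block_op p' q' (coords v)" and "c \<in> fock \<alpha>"
  shows "op_exp \<alpha> A c = V 1 c"
  unfolding op_exp_def
proof (rule the_equality)
  show "\<exists>U. fock_group \<alpha> U \<and> generated_by \<alpha> U A \<and> V 1 c = U 1 c"
    using fock_group_V generated_by_V[OF A] by blast
  show "d = V 1 c" if "\<exists>U. fock_group \<alpha> U \<and> generated_by \<alpha> U A \<and> d = U 1 c" for d
    using that U_eq_V[OF assms(1) _ _ A assms(3)] by blast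
qed

end

section \<open>The map to series\<close>

lemma half_sq_subst_monom: "half_sq_subst (monom a k) = fps_const (a / 2 ^ k) * fps_X ^ (2 * k)"
proof -
  have "map_poly fps_const (monom a k) = monom (fps_const a) k"
    by (simp add: map_poly_monom)
  then have "half_sq_subst (monom a k) = fps_const a * (fps_const (1 / 2) ^ k * (fps_X ^ 2) ^ k)"
    by (simp add: half_sq_subst_def poly_monom power_mult_distrib)
  also have "\<dots> = (fps_const a * fps_const ((1 / 2) ^ k)) * (fps_X ^ 2) ^ k"
    by (simp only: fps_const_power mult.assoc)
  finally show ?thesis
    by (simp add: power_one_over power_mult)
qed

fun phi_gen :: "gen \<Rightarrow> lseries" where
  "phi_gen G1 = 1"
| "phi_gen Gz2 = L2 * L3"
| "phi_gen Gz3 = L1 * L3"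
| "phi_gen Gz4 = L1 * L2"

lemma phi_poly_monomial:
  "phi_poly (abs_fock_poly (monomial (k, g))) = gr_const (fps_const (1 / 2 ^ k) * fps_X ^ (2 * k)) * phi_gen g"
proof -
  have h0: "half_sq_subst 0 = 0" by (simp add: half_sq_subst_def)
  show ?thesis
    unfolding phi_poly.abs_eq phi_op_def zsubst_def zsubst_even_phi
    by (cases g; rule grassmann.expand)
      (simp_all add: monomial_def Z1_power Z2_def Z3_def Z4_def half_sq_subst_monom h0 gr_const_hom
        L1_def L2_def L3_def coeff_pCons)
qed

lemma infsum_eq_single:
  fixes f :: "'a \<Rightarrow> 'b::{comm_monoid_add, t2_space}"
  assumes "\<And>x. x \<noteq> a \<Longrightarrow> f x = 0"
  shows "infsum f UNIV = f a"
proof -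
  have "infsum f UNIV = infsum f {a}"
    using assms by (intro infsum_cong_neutral) auto
  then show ?thesis by simp
qed

text \<open>Each coefficient of the series comes from exactly one index. The monomials with
  \<open>z\<^sub>3\<close> land in the component of \<open>\<ell>\<^sub>3\<close>, which is
  \<open>gr2\<close>, and those with \<open>z\<^sub>4\<close> in that of
  \<open>\<ell>\<^sub>2\<close>, which is \<open>gr1\<close>; both carry an odd power of
  \<open>\<ell>\<^sub>1\<close>.\<close>

lemma phi_nth:
  "fps_nth (gr0 (phi c)) n = (if even n then c (n div 2, G1) / 2 ^ (n div 2) else 0)"
  "fps_nth (gr12 (phi c)) n = (if even n then c (n div 2, Gz2) / 2 ^ (n div 2) else 0)"
  "fps_nth (gr2 (phi c)) n = (if odd n then c (n div 2, Gz3) / 2 ^ (n div 2) else 0)"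
  "fps_nth (gr1 (phi c)) n = (if odd n then c (n div 2, Gz4) / 2 ^ (n div 2) else 0)"
proof -
  let ?img = "\<lambda>b. phi_poly (abs_fock_poly (monomial b))"
  have img: "fps_nth (gr0 (?img (k, g))) n = (if g = G1 \<and> n = 2 * k then 1 / 2 ^ k else 0)"
    "fps_nth (gr12 (?img (k, g))) n = (if g = Gz2 \<and> n = 2 * k then 1 / 2 ^ k else 0)"
    "fps_nth (gr2 (?img (k, g))) n = (if g = Gz3 \<and> n = 2 * k + 1 then 1 / 2 ^ k else 0)"
    "fps_nth (gr1 (?img (k, g))) n = (if g = Gz4 \<and> n = 2 * k + 1 then 1 / 2 ^ k else 0)" for k g
    by (cases g; cases n; simp add: phi_poly_monomial L1_def L2_def L3_def mult.assoc fps_X_power_nth)+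
  have *: "(\<Sum>\<^sub>\<infinity>b. c b * h b) = c (n div 2, g) * h (n div 2, g)"
    if "\<And>k g'. k \<noteq> n div 2 \<or> g' \<noteq> g \<Longrightarrow> h (k, g') = 0" for h :: "idx \<Rightarrow> complex" and g
    by (rule infsum_eq_single) (use that in \<open>force simp: split_paired_all\<close>)
  have even: "(\<Sum>\<^sub>\<infinity>b. c b * h b) = (if even n then c (n div 2, g) / 2 ^ (n div 2) else 0)"
    if "\<And>k g'. h (k, g') = (if g' = g \<and> n = 2 * k then 1 / 2 ^ k else 0)" for h g
    by (subst *[where g = g]) (auto simp: that elim!: evenE oddE)
  have odd: "(\<Sum>\<^sub>\<infinity>b. c b * h b) = (if odd n then c (n div 2, g) / 2 ^ (n div 2) else 0)"
    if "\<And>k g'. h (k, g') = (if g' = g \<and> n = 2 * k + 1 then 1 / 2 ^ k else 0)" for h g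
    by (subst *[where g = g]) (auto simp: that elim!: oddE)
  show "fps_nth (gr0 (phi c)) n = (if even n then c (n div 2, G1) / 2 ^ (n div 2) else 0)"
    unfolding phi_def Let_def grassmann.sel fps_nth_Abs_fps by (rule even[OF img(1)])
  show "fps_nth (gr12 (phi c)) n = (if even n then c (n div 2, Gz2) / 2 ^ (n div 2) else 0)"
    unfolding phi_def Let_def grassmann.sel fps_nth_Abs_fps by (rule even[OF img(2)])
  show "fps_nth (gr2 (phi c)) n = (if odd n then c (n div 2, Gz3) / 2 ^ (n div 2) else 0)"
    unfolding phi_def Let_def grassmann.sel fps_nth_Abs_fps by (rule odd[OF img(3)])
  show "fps_nth (gr1 (phi c)) n = (if odd n then c (n div 2, Gz4) / 2 ^ (n div 2) else 0)"
    unfolding phi_def Let_def grassmann.sel fps_nth_Abs_fps by (rule odd[OF img(4)])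
qed

lemma inj_phi: "inj phi"
proof (rule injI)
  fix c d assume eq: "phi c = phi d"
  have "c (k, g) = d (k, g)" for k g
    using phi_nth(1)[of c "2 * k"] phi_nth(1)[of d "2 * k"] phi_nth(2)[of c "2 * k"] phi_nth(2)[of d "2 * k"]
      phi_nth(3)[of c "2 * k + 1"] phi_nth(3)[of d "2 * k + 1"]
      phi_nth(4)[of c "2 * k + 1"] phi_nth(4)[of d "2 * k + 1"]
    by (cases g) (simp_all add: eq)
  then show "c = d" by auto
qed

lemma rho0_exp_phi:
  assumes "c \<in> fock \<alpha>"
  shows "rho0_exp \<alpha> X (phi c) = phi (op_exp \<alpha> (drho \<alpha> X) c)"
  using inv_into_f_f[OF inj_on_subset[OF inj_phi subset_UNIV] assms] by (simp add: rho0_exp_def)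

text \<open>The normal form depends only on the class, so any representative may be used to compute
  the action in coordinates.\<close>

lemma coords_abs_fock_poly: "coords (abs_fock_poly s) (k, g) = coeff (normal_form g s) k"
proof -
  define c where "c = coords (abs_fock_poly s)"
  have c: "c \<in> fin_coeffs" "of_coeffs c = abs_fock_poly s"
    using coords_fin_coeffs bij_betw_of_coeffs f_inv_into_f[of _ of_coeffs fin_coeffs]
    unfolding c_def coords_def bij_betw_def by auto
  then have "(\<Sum>b | c b \<noteq> 0. cst (c b) * monomial b) - s \<in> fock_ideal"
    by (simp add: of_coeffs_def fock_poly.abs_eq_iff fock_rel_def)
  then have "normal_form g (\<Sum>b | c b \<noteq> 0. cst (c b) * monomial b) = normal_form g s"
    by (simp add: mem_fock_ideal_iff_normal_form normal_form_diff)
  then show ?thesis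
    using coeff_normal_form_sum[OF c(1), of g k] by (simp add: c_def)
qed


section \<open>The action in coordinates\<close>

lemma normal_form_cst_mult: "normal_form g (cst a * s) = smult a (normal_form g s)"
  by (cases g) (simp_all add: cst_def algebra_simps smult_diff_right)

lemma normal_form_dE1: "normal_form g (dE1 s) = (if g = Gz4 then smult (1 / 2) (normal_form Gz3 s) else 0)"
  by (cases g) (simp_all add: dops_def super_defs)

lemma normal_form_dF1: "normal_form g (dF1 s) = (if g = Gz3 then smult 2 (normal_form Gz4 s) else 0)"
  by (cases g) (simp_all add: dops_def super_defs numeral_poly)

lemma normal_form_dH1:
  "normal_form g (dH1 s) = smult (case g of Gz3 \<Rightarrow> - 1 | Gz4 \<Rightarrow> 1 | _ \<Rightarrow> 0) (normal_form g s)"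
  by (cases g) (simp_all add: dops_def super_defs)

lemma normal_form_dH3:
  "normal_form g (dH3 s) = (case g of G1 \<Rightarrow> normal_form Gz2 s | Gz2 \<Rightarrow> normal_form G1 s | _ \<Rightarrow> 0)"
  by (cases g; rule poly_eqI)
    (simp_all add: dops_def super_defs grassmann.map_sel coeff_pderiv numeral_poly coeff_pCons algebra_simps)

lemma coeff_normal_form_Eul1:
  "coeff (normal_form g (Eul1 \<alpha> s)) k
     = (- of_real \<alpha> + of_nat (2 * k) + (if g \<in> {Gz3, Gz4} then 1 else 0)) * coeff (normal_form g s) k"
  by (cases g; cases k) (simp_all add: dops_def super_defs grassmann.map_sel coeff_map_poly coeff_pderiv
      numeral_poly coeff_pCons algebra_simps split: nat.split)

lemma normal_form_Eul2:
  "normal_form g (Eul2 s) = smult (case g of G1 \<Rightarrow> - 1 | Gz2 \<Rightarrow> 1 | _ \<Rightarrow> 0) (normal_form g s)"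
  by (cases g) (simp_all add: dops_def super_defs grassmann.map_sel coeff_pderiv numeral_poly coeff_pCons
      algebra_simps)

text \<open>The summand with \<open>Z1\<close> and \<open>Bz1\<close> is common to both operators
  and cancels. The compact direction is left with the Euler part, which is diagonal in the monomial
  basis.\<close>

lemma normal_form_dF2_dE2:
  "normal_form g (dF2 \<alpha> s) - normal_form g (dE2 \<alpha> s) = smult (- \<i>) (normal_form g (Eul1 \<alpha> s))"
  by (rule poly_eqI) (simp add: numeral_poly dF2_def dE2_def normal_form_add normal_form_diff normal_form_cst_mult)

lemma normal_form_dF3_dE3:
  "normal_form g (dF3 s) - normal_form g (dE3 s) = smult (- \<i>) (normal_form g (Eul2 s))"
  by (rule poly_eqI) (simp add: numeral_poly dF3_def dE3_def normal_form_add normal_form_diff normal_form_cst_mult)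

lemma mat_entries [simp]:
  "matE $ 1 $ 1 = 0" "matE $ 1 $ 2 = 1" "matE $ 2 $ 1 = 0" "matE $ 2 $ 2 = 0"
  "matF $ 1 $ 1 = 0" "matF $ 1 $ 2 = 0" "matF $ 2 $ 1 = 1" "matF $ 2 $ 2 = 0"
  "matH $ 1 $ 1 = 1" "matH $ 1 $ 2 = 0" "matH $ 2 $ 1 = 0" "matH $ 2 $ 2 = - 1"
  by (simp_all add: matE_def matF_def matH_def)

lemma normal_form_drho_op:
  "normal_form g (drho_op \<alpha> (k *\<^sub>R (matF - matE), 0, 0) s)
     = smult (of_real k) (normal_form g (dF1 s) - normal_form g (dE1 s))"
  "normal_form g (drho_op \<alpha> (0, k *\<^sub>R (matF - matE), 0) s)
     = smult (of_real k) (smult (- \<i>) (normal_form g (Eul1 \<alpha> s)))"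
  "normal_form g (drho_op \<alpha> (0, 0, k *\<^sub>R (matF - matE)) s)
     = smult (of_real k) (smult (- \<i>) (normal_form g (Eul2 s)))"
  "normal_form g (drho_op \<alpha> (k *\<^sub>R matH, 0, 0) s) = smult (of_real k) (normal_form g (dH1 s))"
  "normal_form g (drho_op \<alpha> (0, 0, k *\<^sub>R matH) s) = smult (of_real k) (normal_form g (dH3 s))"
  unfolding normal_form_dF2_dE2[symmetric] normal_form_dF3_dE3[symmetric]
  by (simp_all add: normal_form_add normal_form_cst_mult normal_form_diff smult_diff_right)


section \<open>The block groups of the five one-parameter subgroups\<close>

lemma block_group_diag:
  assumes re: "\<And>b. \<bar>Re (\<mu> b)\<bar> \<le> C"
  shows "block_group (\<lambda>t b. exp (of_real t * \<mu> b)) (\<lambda>_ _. 0) \<mu> (\<lambda>_. 0)"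
proof
  fix b :: idx
  show "((\<lambda>t. exp (of_real t * \<mu> b)) has_vector_derivative \<mu> b) (at 0)"
    by (auto intro!: derivative_eq_intros has_vector_derivative_real_field)
next
  fix r :: real
  \<comment> \<open>Only real parts affect the modulus. The imaginary parts may be unbounded in
    \<open>b\<close>, as they are for \<open>K\<^sub>2\<close> when its parameter is
    nonzero.\<close>
  have "cmod (exp (of_real t * \<mu> b)) \<le> exp (r * C)" if "\<bar>t\<bar> \<le> r" for t b
  proof -
    have "t * Re (\<mu> b) \<le> \<bar>t\<bar> * \<bar>Re (\<mu> b)\<bar>"
      by (metis abs_ge_self abs_mult)
    also have "\<dots> \<le> r * C"
      using that re[of b] by (intro mult_mono) auto
    finally show ?thesis by simp
  qed
  then show "\<exists>M. \<forall>t b. \<bar>t\<bar> \<le> r \<longrightarrow> cmod (exp (of_real t * \<mu> b)) \<le> M \<and> cmod 0 \<le> M"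
    by (intro exI[of _ "exp (r * C)"]) auto
qed (simp_all add: exp_add algebra_simps)

text \<open>On the coefficients of \<open>z\<^sub>3\<close>, \<open>z\<^sub>4\<close> the generator
  has rows (0, 2k) and (-k/2, 0), with square -k^2. Its exponential is a rotation up to rescaling,
  and the factors 2 and 1/2 cancel in the addition laws.\<close>

lemma block_group_K1:
  "block_group
     (\<lambda>t (_, g). case g of Gz3 \<Rightarrow> of_real (cos (k * t)) | Gz4 \<Rightarrow> of_real (cos (k * t)) | _ \<Rightarrow> 1)
     (\<lambda>t (_, g). case g of Gz3 \<Rightarrow> of_real (2 * sin (k * t)) | Gz4 \<Rightarrow> of_real (- sin (k * t) / 2) | _ \<Rightarrow> 0)
     (\<lambda>_. 0)
     (\<lambda>(_, g). case g of Gz3 \<Rightarrow> of_real (2 * k) | Gz4 \<Rightarrow> of_real (- k / 2) | _ \<Rightarrow> 0)"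
  (is "block_group ?p ?q _ ?q'")
proof
  fix s t :: real and b :: idx
  show "?p (s + t) b = ?p s b * ?p t b + ?q s b * ?q t (swap_gen b)"
    "?q (s + t) b = ?p s b * ?q t b + ?q s b * ?p t (swap_gen b)"
    by (cases b rule: swap_gen.cases;
        simp add: cos_add sin_add distrib_left flip: of_real_mult of_real_add of_real_diff;
        simp add: algebra_simps)+
next
  fix b :: idx
  show "((\<lambda>t. ?p t b) has_vector_derivative 0) (at 0)"
    "((\<lambda>t. ?q t b) has_vector_derivative ?q' b) (at 0)"
    by (cases b rule: swap_gen.cases;
        auto intro!: derivative_eq_intros has_vector_derivative_of_real
          simp: has_real_derivative_iff_has_vector_derivative[symmetric])+
next
  fix r :: real
  have "cmod (?p t b) \<le> 2 \<and> cmod (?q t b) \<le> 2" for t b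
  proof -
    \<comment> \<open>The bound 4 on the sine is what keeps the entry \<open>sin (k * t) / 2\<close>
      within 2.\<close>
    have "\<bar>cos (k * t)\<bar> \<le> 2" "\<bar>sin (k * t)\<bar> \<le> 4"
      using abs_cos_le_one[of "k * t"] abs_sin_le_one[of "k * t"] by linarith+
    then show ?thesis
      by (cases b rule: swap_gen.cases) (auto simp: norm_mult norm_divide)
  qed
  then show "\<exists>M. \<forall>t b. \<bar>t\<bar> \<le> r \<longrightarrow> cmod (?p t b) \<le> M \<and> cmod (?q t b) \<le> M"
    by blast
qed (auto split: gen.split)

lemma block_group_A3:
  "block_group
     (\<lambda>t (_, g). case g of G1 \<Rightarrow> of_real (cosh (a * t)) | Gz2 \<Rightarrow> of_real (cosh (a * t)) | _ \<Rightarrow> 1)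
     (\<lambda>t (_, g). case g of G1 \<Rightarrow> of_real (sinh (a * t)) | Gz2 \<Rightarrow> of_real (sinh (a * t)) | _ \<Rightarrow> 0)
     (\<lambda>_. 0)
     (\<lambda>(_, g). case g of G1 \<Rightarrow> of_real a | Gz2 \<Rightarrow> of_real a | _ \<Rightarrow> 0)"
  (is "block_group ?p ?q _ ?q'")
proof
  fix s t :: real and b :: idx
  show "?p (s + t) b = ?p s b * ?p t b + ?q s b * ?q t (swap_gen b)"
    "?q (s + t) b = ?p s b * ?q t b + ?q s b * ?p t (swap_gen b)"
    by (cases b rule: swap_gen.cases;
        simp add: cosh_add sinh_add distrib_left flip: of_real_mult of_real_add;
        simp add: algebra_simps)+
next
  fix b :: idx
  show "((\<lambda>t. ?p t b) has_vector_derivative 0) (at 0)"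
    "((\<lambda>t. ?q t b) has_vector_derivative ?q' b) (at 0)"
    by (cases b rule: swap_gen.cases;
        auto intro!: derivative_eq_intros has_vector_derivative_of_real
          simp: has_real_derivative_iff_has_vector_derivative[symmetric])+
next
  fix r :: real
  \<comment> \<open>The hyperbolic cosine is even and increasing in the absolute value, and it
    dominates the absolute value of the hyperbolic sine.\<close>
  define M where "M = cosh (a * r)"
  have "1 \<le> M" by (simp add: M_def cosh_real_ge_1)
  have "cmod (?p t b) \<le> M \<and> cmod (?q t b) \<le> M" if "\<bar>t\<bar> \<le> r" for t b
  proof -
    have "\<bar>a * t\<bar> \<le> \<bar>a * r\<bar>"
      using that by (auto simp: abs_mult intro: mult_left_mono)
    then have "cosh (a * t) \<le> M"
      using cosh_real_nonneg_le_iff[of "\<bar>a * t\<bar>" "\<bar>a * r\<bar>"] by (simp add: M_def)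
    moreover have "\<bar>sinh (a * t)\<bar> \<le> cosh (a * t)"
      using sinh_less_cosh_real[of "a * t"] sinh_less_cosh_real[of "- (a * t)"] by (simp add: abs_if)
    ultimately show ?thesis
      using \<open>1 \<le> M\<close> by (cases b rule: swap_gen.cases) auto
  qed
  then show "\<exists>M. \<forall>t b. \<bar>t\<bar> \<le> r \<longrightarrow> cmod (?p t b) \<le> M \<and> cmod (?q t b) \<le> M"
    by blast
qed (auto split: gen.split)

text \<open>Reduces each formula to one check on normal forms: the infinitesimal action must be the
  block operator with entries \<open>p'\<close>, \<open>q'\<close>. The group element is then the
  block at time 1.\<close>

lemma rho0_exp_block_group:
  assumes "block_group p q p' q'" and "\<alpha> \<notin> \<nat>" and "c \<in> fock \<alpha>"
    and nf: "\<And>s k g. coeff (normal_form g (drho_op \<alpha> X s)) k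
      = block_op p' q' (\<lambda>(k, g). coeff (normal_form g s) k) (k, g)"
  shows "rho0_exp \<alpha> X (phi c) = phi (block_op (p 1) (q 1) c)"
proof -
  have "coords (drho \<alpha> X v) = block_op p' q' (coords v)" for v
  proof -
    obtain s where v: "v = abs_fock_poly s"
      using Quotient3_abs_rep[OF Quotient3_fock_poly] by metis
    have "coords v = (\<lambda>(k, g). coeff (normal_form g s) k)"
      by (auto simp: v coords_abs_fock_poly)
    moreover have "coords (drho \<alpha> X v) (k, g) = coeff (normal_form g (drho_op \<alpha> X s)) k" for k g
      by (simp add: v drho.abs_eq coords_abs_fock_poly)
    ultimately show ?thesis
      by (auto simp: nf)
  qed
  then show ?thesis
    using block_group.op_exp_eq[OF assms(1,2) _ assms(3)] by (simp add: rho0_exp_phi assms(3))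
qed

section \<open>The five formulas, coefficient by coefficient\<close>

lemma lsubst_X:
  "lsubst f fps_X y2 y3 = gr_const (gr0 f) + gr_const (gr1 f) * y2 + gr_const (gr2 f) * y3
     + gr_const (gr12 f) * y2 * y3"
  by (simp add: lsubst_def)

lemma rho0_exp_K1:
  assumes "\<alpha> \<notin> \<nat>" "c \<in> fock \<alpha>"
  shows "rho0_exp \<alpha> (k *\<^sub>R (matF - matE), 0, 0) (phi c) =
    lsubst (phi c) fps_X
      (lcst (cos k) * L2 + lcst (2 * sin k) * L3) (lcst (- sin k / 2) * L2 + lcst (cos k) * L3)"
proof -
  \<comment> \<open>In the component of \<open>\<ell>\<^sub>2 \<ell>\<^sub>3\<close> the
    substitution produces its determinant cos^2 + sin^2 = 1, in accordance with the trivial action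
    on \<open>z\<^sub>1\<^sup>k z\<^sub>2\<close>.\<close>
  have cos_sin: "complex_of_real (cos k) * (of_real (cos k) * x) / d + of_real (sin k) * (of_real (sin k) * x) / d = x / d"
    for x d
  proof -
    have "complex_of_real ((cos k)\<^sup>2 + (sin k)\<^sup>2) * x / d = x / d"
      by simp
    then show ?thesis
      by (simp only: of_real_add of_real_mult power2_eq_square distrib_right add_divide_distrib mult.assoc)
  qed
  have "coeff (normal_form g (drho_op \<alpha> (k *\<^sub>R (matF - matE), 0, 0) s)) m
      = block_op (\<lambda>_. 0)
          (\<lambda>(_, g). case g of Gz3 \<Rightarrow> of_real (2 * k) | Gz4 \<Rightarrow> of_real (- k / 2) | _ \<Rightarrow> 0)
          (\<lambda>(m, g). coeff (normal_form g s) m) (m, g)" for s m g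
    unfolding normal_form_drho_op normal_form_dE1 normal_form_dF1
    by (cases g) (simp_all add: block_op_def del: normal_form.simps)
  note rho = rho0_exp_block_group[OF block_group_K1 assms this]
  show ?thesis
    unfolding rho
    by (intro grassmann.expand conjI fps_ext)
      (simp_all add: block_op_def phi_nth lcst_def L2_def L3_def lsubst_X algebra_simps add_divide_distrib diff_divide_distrib cos_sin)
qed

lemma rho0_exp_K2:
  assumes "\<alpha> \<notin> \<nat>" "c \<in> fock \<alpha>"
  shows "rho0_exp \<alpha> (0, k *\<^sub>R (matF - matE), 0) (phi c) =
    lcst (exp (\<i> * \<alpha> * k)) * lsubst (phi c) (fps_const (exp (- \<i> * k)) * fps_X) L2 L3"
proof -
  define l where "l = (\<lambda>(n, g). - \<i> * of_real k * (- of_real \<alpha> + of_nat (2 * n) + (if g \<in> {Gz3, Gz4} then 1 else 0)))"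
  have G: "block_group (\<lambda>t b. exp (of_real t * l b)) (\<lambda>_ _. 0) l (\<lambda>_. 0)"
    by (rule block_group_diag[of _ 0]) (auto simp: l_def)
  \<comment> \<open>For the parity belonging to \<open>g\<close>, the degree n in
    \<open>\<ell>\<^sub>1\<close> is 2 (n div 2) plus 0 or 1. The eigenvalue is therefore affine in
    n, and its exponential is a constant times an n-th power, as in rescaling
    \<open>\<ell>\<^sub>1\<close>.\<close>
  have e: "exp (l (n div 2, g)) = exp (\<i> * \<alpha> * k) * exp (- \<i> * k) ^ n"
    if "odd n \<longleftrightarrow> g \<in> {Gz3, Gz4}" for n g
  proof -
    have "of_nat n = of_nat (2 * (n div 2)) + (if g \<in> {Gz3, Gz4} then 1 else 0 :: complex)"
      using that by (cases "even n") (auto elim!: evenE oddE)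
    then have "l (n div 2, g) = \<i> * \<alpha> * k + of_nat n * (- \<i> * k)"
      by (simp add: l_def algebra_simps)
    then show ?thesis
      by (simp only: exp_add exp_of_nat_mult)
  qed
  have "coeff (normal_form g (drho_op \<alpha> (0, k *\<^sub>R (matF - matE), 0) s)) m
      = block_op l (\<lambda>_. 0)
          (\<lambda>(m, g). coeff (normal_form g s) m) (m, g)" for s m g
    unfolding normal_form_drho_op
    by (cases g) (simp_all add: block_op_def coeff_normal_form_Eul1 l_def del: normal_form.simps)
  note rho = rho0_exp_block_group[OF G assms this]
  show ?thesis
    unfolding rho
    by (intro grassmann.expand conjI fps_ext)
      (auto simp: block_op_def phi_nth lcst_def L2_def L3_def lsubst_def fps_compose_linear e)
qed

text \<open>A term of degree d in \<open>\<ell>\<^sub>2\<close>, \<open>\<ell>\<^sub>3\<close> is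
  multiplied by exp(i k (1 - d)), where d is 0, 1 or 2.\<close>

lemma rho0_exp_K3:
  assumes "\<alpha> \<notin> \<nat>" "c \<in> fock \<alpha>"
  shows "rho0_exp \<alpha> (0, 0, k *\<^sub>R (matF - matE)) (phi c) =
    lcst (exp (\<i> * k)) * lsubst (phi c) fps_X (lcst (exp (- \<i> * k)) * L2) (lcst (exp (- \<i> * k)) * L3)"
proof -
  let ?l = "\<lambda>(n :: nat, g). - \<i> * of_real k * (case g of G1 \<Rightarrow> - 1 | Gz2 \<Rightarrow> 1 | _ \<Rightarrow> 0)"
  have G: "block_group (\<lambda>t b. exp (of_real t * ?l b)) (\<lambda>_ _. 0) ?l (\<lambda>_. 0)"
    by (rule block_group_diag[of _ 0]) (auto split: gen.split)
  have "coeff (normal_form g (drho_op \<alpha> (0, 0, k *\<^sub>R (matF - matE)) s)) m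
      = block_op ?l (\<lambda>_. 0)
          (\<lambda>(m, g). coeff (normal_form g s) m) (m, g)" for s m g
    unfolding normal_form_drho_op normal_form_Eul2
    by (cases g) (simp_all add: block_op_def del: normal_form.simps)
  note rho = rho0_exp_block_group[OF G assms this]
  show ?thesis
    unfolding rho
    by (intro grassmann.expand conjI fps_ext)
      (simp_all add: block_op_def phi_nth lcst_def L2_def L3_def lsubst_X exp_minus)
qed

lemma rho0_exp_A1:
  assumes "\<alpha> \<notin> \<nat>" "c \<in> fock \<alpha>"
  shows "rho0_exp \<alpha> (a *\<^sub>R matH, 0, 0) (phi c) =
    lsubst (phi c) fps_X (lcst (exp a) * L2) (lcst (exp (- a)) * L3)"
proof -
  let ?l = "\<lambda>(n :: nat, g). complex_of_real a * (case g of Gz3 \<Rightarrow> - 1 | Gz4 \<Rightarrow> 1 | _ \<Rightarrow> 0)"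
  have G: "block_group (\<lambda>t b. exp (of_real t * ?l b)) (\<lambda>_ _. 0) ?l (\<lambda>_. 0)"
    by (rule block_group_diag[of _ "\<bar>a\<bar>"]) (auto split: gen.split)
  have "coeff (normal_form g (drho_op \<alpha> (a *\<^sub>R matH, 0, 0) s)) m
      = block_op ?l (\<lambda>_. 0)
          (\<lambda>(m, g). coeff (normal_form g s) m) (m, g)" for s m g
    unfolding normal_form_drho_op normal_form_dH1
    by (cases g) (simp_all add: block_op_def del: normal_form.simps)
  note rho = rho0_exp_block_group[OF G assms this]
  show ?thesis
    unfolding rho
    by (intro grassmann.expand conjI fps_ext)
      (simp_all add: block_op_def phi_nth lcst_def L2_def L3_def lsubst_X exp_minus exp_of_real)
qed

text \<open>Both alternating sums isolate the \<open>\<ell>\<^sub>2 \<ell>\<^sub>3\<close> part of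
  the series, the first with \<open>\<ell>\<^sub>2 \<ell>\<^sub>3\<close> replaced by 1. The first
  thus supplies the sinh entry from \<open>z\<^sub>1\<^sup>k z\<^sub>2\<close> to
  \<open>z\<^sub>1\<^sup>k\<close>, and the second corrects the diagonal entry.\<close>

lemma rho0_exp_A3:
  assumes "\<alpha> \<notin> \<nat>" "c \<in> fock \<alpha>"
  shows "rho0_exp \<alpha> (0, 0, a *\<^sub>R matH) (phi c) =
    (lcst (cosh a) + lcst (sinh a) * L2 * L3) *
      lsubst (phi c) fps_X (lcst (inverse (cosh a)) * L2) (lcst (inverse (cosh a)) * L3)
    + lcst (sinh a) *
        (lsubst (phi c) fps_X 1 1 - lsubst (phi c) fps_X 1 0 - lsubst (phi c) fps_X 0 1 + lsubst (phi c) fps_X 0 0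
         + lcst (tanh a) *
             (lsubst (phi c) fps_X L2 L3 - lsubst (phi c) fps_X L2 0 - lsubst (phi c) fps_X 0 L3
              + lsubst (phi c) fps_X 0 0))"
proof -
  \<comment> \<open>The diagonal entry at \<open>\<ell>\<^sub>2 \<ell>\<^sub>3\<close>: sinh^2 /
    cosh from the correction plus cosh / cosh^2 from the rescaling equals cosh.\<close>
  have cosh_sinh: "complex_of_real (sinh a) * (of_real (sinh a) * x) / (of_real (cosh a) * d)
      + of_real (cosh a) * (inverse (of_real (cosh a)) * (inverse (of_real (cosh a)) * x)) / d
      = of_real (cosh a) * x / d" for x d
  proof -
    let ?C = "complex_of_real (cosh a)" and ?S = "complex_of_real (sinh a)"
    have C: "?C \<noteq> 0" by simp
    have "?S * (?S * x) / (?C * d) + ?C * (inverse ?C * (inverse ?C * x)) / d = (?S * ?S + 1) * x / (?C * d)"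
      using C by (simp add: divide_simps algebra_simps)
    also have "?S * ?S + 1 = ?C * ?C"
      using arg_cong[OF cosh_square_eq[of a], of complex_of_real] by (simp add: power2_eq_square)
    also have "?C * ?C * x / (?C * d) = ?C * x / d"
      using C by (simp add: divide_simps)
    finally show ?thesis .
  qed
  have "coeff (normal_form g (drho_op \<alpha> (0, 0, a *\<^sub>R matH) s)) m
      = block_op (\<lambda>_. 0)
          (\<lambda>(_, g). case g of G1 \<Rightarrow> of_real a | Gz2 \<Rightarrow> of_real a | _ \<Rightarrow> 0)
          (\<lambda>(m, g). coeff (normal_form g s) m) (m, g)" for s m g
    unfolding normal_form_drho_op normal_form_dH3
    by (cases g) (simp_all add: block_op_def del: normal_form.simps)
  note rho = rho0_exp_block_group[OF block_group_A3 assms this]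
  show ?thesis
    unfolding rho
    by (intro grassmann.expand conjI fps_ext)
      (simp_all add: block_op_def phi_nth lcst_def L2_def L3_def lsubst_X algebra_simps add_divide_distrib tanh_def cosh_sinh)
qed

theorem corollary5p3:
  fixes \<alpha> k1 k2 k3 a1 a3 :: real and f :: lseries
  assumes "\<alpha> \<notin> \<nat>"
    and "f \<in> phi ` fock \<alpha>"
  shows
    "(rho0_exp \<alpha> (k1 *\<^sub>R (matF - matE), 0, 0) f =
       lsubst f fps_X
         (lcst (cos k1) * L2 + lcst (2 * sin k1) * L3)
         (lcst (- sin k1 / 2) * L2 + lcst (cos k1) * L3)) \<and>
     (rho0_exp \<alpha> (0, k2 *\<^sub>R (matF - matE), 0) f =
       lcst (exp (\<i> * \<alpha> * k2)) * lsubst f (fps_const (exp (- \<i> * k2)) * fps_X) L2 L3) \<and>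
     (rho0_exp \<alpha> (0, 0, k3 *\<^sub>R (matF - matE)) f =
       lcst (exp (\<i> * k3)) *
         lsubst f fps_X (lcst (exp (- \<i> * k3)) * L2) (lcst (exp (- \<i> * k3)) * L3)) \<and>
     (rho0_exp \<alpha> (a1 *\<^sub>R matH, 0, 0) f =
       lsubst f fps_X (lcst (exp a1) * L2) (lcst (exp (- a1)) * L3)) \<and>
     (rho0_exp \<alpha> (0, 0, a3 *\<^sub>R matH) f =
       (lcst (cosh a3) + lcst (sinh a3) * L2 * L3) *
         lsubst f fps_X (lcst (inverse (cosh a3)) * L2) (lcst (inverse (cosh a3)) * L3)
       + lcst (sinh a3) *
           (lsubst f fps_X 1 1 - lsubst f fps_X 1 0 - lsubst f fps_X 0 1 + lsubst f fps_X 0 0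
            + lcst (tanh a3) *
                (lsubst f fps_X L2 L3 - lsubst f fps_X L2 0 - lsubst f fps_X 0 L3
                 + lsubst f fps_X 0 0)))"
proof -
  from assms(2) obtain c where f: "f = phi c" and c: "c \<in> fock \<alpha>"
    by (rule imageE)
  show ?thesis
    unfolding f
    by (intro conjI rho0_exp_K1[OF assms(1) c, of k1] rho0_exp_K2[OF assms(1) c, of k2]
        rho0_exp_K3[OF assms(1) c, of k3] rho0_exp_A1[OF assms(1) c, of a1]
        rho0_exp_A3[OF assms(1) c, of a3])
qed

end
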